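(* If a graph $G$ is not chordal, then for every labeling of its vertices by $1,\ldots,n$ and every initial elimination forest $F_0$ for $G$, Algorithm R terminates before visiting all elimination forests for $G$.
   Context: A graph is chordal if every induced cycle has length three. An elimination tree for a connected graph $G$ is a rooted tree on its vertex set consisting of a root $x$ whose children are the roots of elimination trees for the components of $G-x$ (unordered). An elimination forest is one elimination tree per component. Rotation of a tree edge $\{i,j\}$, where $i$ is the parent of $j$: let $H$ be the subgraph induced by the subtree rooted at $i$. Then $j$ takes $i$'s place (child of $i$'s former parent, or root), $i$ becomes a child of $j$, subtrees of $i$ stay with $i$, and each subtree $S$ of $j$ stays with $j$ unless $S$ lies in the same component of $H-j$ as $i$, in which case it moves to $i$. Up-rotation of $j$: rotate the edge to its parent $i<j$. Down-rotation of $j$: rotate an edge to a child $i<j$. Algorithm R on $G=([n],E)$ with initial forest $F_0$: visit $F_0$. Then repeatedly, in the last visited forest, let $j$ be the largest vertex admitting an up- or down-rotation producing an unvisited forest. Terminate if no such $j$ exists, or if more than one edge $\{i,j\}$ with $i<j$ produces an unvisited forest. Otherwise perform that rotation, visit the result, and continue. *)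

theory Defs
  imports Main
begin

definition simple_graph :: "'a set \<Rightarrow> 'a set set \<Rightarrow> bool" where
  "simple_graph V E \<longleftrightarrow> finite V \<and> (\<forall>e\<in>E. e \<subseteq> V \<and> card e = 2)"

definition induced_cycle :: "'a set \<Rightarrow> 'a set set \<Rightarrow> 'a list \<Rightarrow> bool" where
  "induced_cycle V E xs \<longleftrightarrow> length xs \<ge> 3 \<and> distinct xs \<and> set xs \<subseteq> V \<and>
     (\<forall>a<length xs. \<forall>b<length xs. {xs ! a, xs ! b} \<in> E \<longleftrightarrow>
        b = Suc a mod length xs \<or> a = Suc b mod length xs)"

definition chordal :: "'a set \<Rightarrow> 'a set set \<Rightarrow> bool" where
  "chordal V E \<longleftrightarrow> (\<forall>xs. induced_cycle V E xs \<longrightarrow> length xs = 3)"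

definition induced_adj :: "'a set set \<Rightarrow> 'a set \<Rightarrow> 'a rel" where
  "induced_adj E U = {(u, v). u \<in> U \<and> v \<in> U \<and> {u, v} \<in> E}"

definition component :: "'a set set \<Rightarrow> 'a set \<Rightarrow> 'a \<Rightarrow> 'a set" where
  "component E U u = (induced_adj E U)\<^sup>* `` {u}"

definition components :: "'a set set \<Rightarrow> 'a set \<Rightarrow> 'a set set" where
  "components E U = component E U ` U"

definition connected_on :: "'a set set \<Rightarrow> 'a set \<Rightarrow> bool" where
  "connected_on E U \<longleftrightarrow> U \<noteq> {} \<and> (\<forall>u\<in>U. \<forall>v\<in>U. (u, v) \<in> (induced_adj E U)\<^sup>*)"

text \<open>
  A rooted forest on a fixed vertex set is represented by its set of arcs
  \<open>(parent, child)\<close>, so that equality of arc sets is equality of unordered rooted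
  forests. The predicate \<open>elim_tree E U x T\<close> says that \<open>T\<close> is an elimination tree with
  root \<open>x\<close> for the subgraph induced by \<open>U\<close>; the functions \<open>r\<close> and \<open>S\<close> choose, for
  each component, the root and the arcs of an elimination tree.
\<close>

inductive elim_tree :: "'a set set \<Rightarrow> 'a set \<Rightarrow> 'a \<Rightarrow> 'a rel \<Rightarrow> bool" for E :: "'a set set" where
  elim_treeI: "connected_on E U \<Longrightarrow> x \<in> U \<Longrightarrow>
    (\<And>C. C \<in> components E (U - {x}) \<Longrightarrow> elim_tree E C (r C) (S C)) \<Longrightarrow>
    elim_tree E U x (\<Union>C\<in>components E (U - {x}). insert (x, r C) (S C))"

definition elim_forest :: "'a set \<Rightarrow> 'a set set \<Rightarrow> 'a rel \<Rightarrow> bool" where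
  "elim_forest V E F \<longleftrightarrow> (\<exists>S. (\<forall>C\<in>components E V. \<exists>x. elim_tree E C x (S C)) \<and>
     F = (\<Union>C\<in>components E V. S C))"

definition subtree :: "'a rel \<Rightarrow> 'a \<Rightarrow> 'a set" where
  "subtree F i = F\<^sup>* `` {i}"

text \<open>
  The children of \<open>j\<close> whose subtrees move from \<open>j\<close> to \<open>i\<close> when the arc from \<open>i\<close>
  (parent) to \<open>j\<close> (child) is rotated.
\<close>

definition moved :: "'a set set \<Rightarrow> 'a rel \<Rightarrow> 'a \<Rightarrow> 'a \<Rightarrow> 'a set" where
  "moved E F i j = {k. (j, k) \<in> F \<and> subtree F k \<subseteq> component E (subtree F i - {j}) i}"

definition rotation :: "'a set set \<Rightarrow> 'a rel \<Rightarrow> 'a \<Rightarrow> 'a \<Rightarrow> 'a rel" where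
  "rotation E F i j =
     {(a, b) \<in> F. b \<noteq> i \<and> b \<noteq> j \<and> b \<notin> moved E F i j}
     \<union> {(a, j) | a. (a, i) \<in> F} \<union> {(j, i)} \<union> {(i, k) | k. k \<in> moved E F i j}"

text \<open>
  In the following sets of pairs \<open>(i, F')\<close>, the component \<open>i\<close> identifies the rotated
  edge \<open>{i, j}\<close>, so that counting pairs counts edges, and \<open>F'\<close> is the resulting forest.
\<close>

definition up_rotations :: "nat set set \<Rightarrow> nat rel \<Rightarrow> nat \<Rightarrow> (nat \<times> nat rel) set" where
  "up_rotations E F j = {(i, rotation E F i j) | i. i < j \<and> (i, j) \<in> F}"

definition down_rotations :: "nat set set \<Rightarrow> nat rel \<Rightarrow> nat \<Rightarrow> (nat \<times> nat rel) set" where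
  "down_rotations E F j = {(i, rotation E F j i) | i. i < j \<and> (j, i) \<in> F}"

definition new_rotations :: "nat set set \<Rightarrow> nat rel list \<Rightarrow> nat \<Rightarrow> (nat \<times> nat rel) set" where
  "new_rotations E Fs j =
     {(i, F') \<in> up_rotations E (last Fs) j \<union> down_rotations E (last Fs) j. F' \<notin> set Fs}"

text \<open>
  The forest visited next by Algorithm R, given the list \<open>Fs\<close> of the forests visited so
  far in order of visit; \<open>None\<close> means that the algorithm terminates.
\<close>

definition alg_R_next :: "nat set set \<Rightarrow> nat rel list \<Rightarrow> nat rel option" where
  "alg_R_next E Fs =
     (let J = {j. new_rotations E Fs j \<noteq> {}}; N = new_rotations E Fs (Max J)
      in if J = {} \<or> card N > 1 then None else Some (snd (the_elem N)))"

inductive alg_R_visits :: "nat set set \<Rightarrow> nat rel \<Rightarrow> nat rel list \<Rightarrow> bool"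
  for E :: "nat set set" and F0 :: "nat rel" where
  start: "alg_R_visits E F0 [F0]"
| visit: "alg_R_visits E F0 Fs \<Longrightarrow> alg_R_next E Fs = Some F \<Longrightarrow> alg_R_visits E F0 (Fs @ [F])"

definition alg_R_terminates_with :: "nat set set \<Rightarrow> nat rel \<Rightarrow> nat rel list \<Rightarrow> bool" where
  "alg_R_terminates_with E F0 Fs \<longleftrightarrow> alg_R_visits E F0 Fs \<and> alg_R_next E Fs = None"

end

theory Submission
  imports Defs "HOL-Combinatorics.Transposition"
begin

text \<open>
  Eliminating the vertices one by one in a linear order produces an elimination forest, every
  elimination forest arises in this way, and the rotation of an edge between \<open>i\<close> and \<open>j\<close> is the
  exchange of \<open>i\<close> and \<open>j\<close> in an order in which they are consecutive.

  Suppose a run visits all elimination forests, and let \<open>n\<close> be the largest vertex. Two forests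
  that differ by a rotation of an edge at \<open>n\<close> must be visited consecutively, because the earlier
  of the two still has an unvisited rotation at the top level. So in every forest \<open>n\<close> has at most
  two incident tree edges. If \<open>n\<close> had two non-adjacent neighbours \<open>a\<close>, \<open>b\<close> and its component a
  fourth vertex, then some forest would contain \<open>n\<close> with children \<open>a\<close>, \<open>b\<close> and a parent; hence
  \<open>n\<close> is simplicial or its component has at most three vertices, and in either case \<open>n\<close> lies on
  no induced cycle of length at least four. Deleting \<open>n\<close> from the orders projects forests of \<open>G\<close>
  onto forests of \<open>G - n\<close>. The fibres are connected by rotations at \<open>n\<close>, so the run visits each
  fibre contiguously, and collapsing the fibres gives a run on \<open>G - n\<close> that visits everything.
  Induction on the number of vertices finishes the proof.
\<close>

section \<open>Connected components\<close>

lemma component_refl [simp]: "u \<in> component E U u"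
  by (simp add: component_def)

lemma component_minimal:
  assumes "u \<in> C" and "\<And>x y. x \<in> C \<Longrightarrow> x \<in> U \<Longrightarrow> y \<in> U \<Longrightarrow> {x, y} \<in> E \<Longrightarrow> y \<in> C"
  shows "component E U u \<subseteq> C"
proof
  fix v assume "v \<in> component E U u"
  then have "(u, v) \<in> (induced_adj E U)\<^sup>*" by (simp add: component_def)
  then show "v \<in> C"
    by (induction rule: rtrancl_induct) (use assms in \<open>auto simp: induced_adj_def\<close>)
qed

lemma component_step:
  "x \<in> component E U u \<Longrightarrow> x \<in> U \<Longrightarrow> y \<in> U \<Longrightarrow> {x, y} \<in> E \<Longrightarrow> y \<in> component E U u"
  unfolding component_def by (auto simp: induced_adj_def intro: rtrancl_into_rtrancl)

lemma component_subset: "u \<in> U \<Longrightarrow> component E U u \<subseteq> U"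
  by (rule component_minimal)

lemma component_mono:
  assumes "U \<subseteq> W"
  shows "component E U u \<subseteq> component E W u"
proof (rule component_minimal)
  fix x y assume "x \<in> component E W u" "x \<in> U" "y \<in> U" "{x, y} \<in> E"
  then show "y \<in> component E W u" using assms component_step[of x E W u y] by blast
qed simp

lemma component_eq:
  assumes "v \<in> component E U u"
  shows "component E U v = component E U u"
proof -
  have "sym (induced_adj E U)" by (auto simp: sym_def induced_adj_def insert_commute)
  then have "sym ((induced_adj E U)\<^sup>*)" by (rule sym_rtrancl)
  moreover have "(u, v) \<in> (induced_adj E U)\<^sup>*" using assms by (simp add: component_def)
  ultimately show ?thesis
    unfolding component_def by (auto intro: rtrancl_trans dest: symD)
qed

lemma component_absorb:
  assumes "component E U u \<subseteq> W" "W \<subseteq> U"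
  shows "component E W u = component E U u"
proof
  show "component E W u \<subseteq> component E U u" using assms(2) by (rule component_mono)
  have "component E U u \<subseteq> component E W u \<inter> component E U u"
  proof (rule component_minimal)
    fix x y
    assume x: "x \<in> component E W u \<inter> component E U u" and xy: "x \<in> U" "y \<in> U" "{x, y} \<in> E"
    then have "y \<in> component E U u" using component_step[of x E U u y] by blast
    moreover from this have "y \<in> component E W u"
      using x xy assms component_step[of x E W u y] by blast
    ultimately show "y \<in> component E W u \<inter> component E U u" by simp
  qed simp
  then show "component E U u \<subseteq> component E W u" by simp
qed

lemma component_component_Diff:
  assumes "u \<in> A" "u \<notin> B"
  shows "component E (component E A u - B) u = component E (A - B) u"
proof -
  have "component E (A - B) u \<subseteq> component E A u" by (rule component_mono) auto
  moreover have "component E (A - B) u \<subseteq> A - B" by (rule component_subset) (use assms in auto)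
  moreover have "component E A u \<subseteq> A" by (rule component_subset) fact
  ultimately show ?thesis by (intro component_absorb) auto
qed

lemma component_component: "u \<in> A \<Longrightarrow> component E (component E A u) u = component E A u"
  using component_component_Diff[of u A "{}"] by simp

lemma component_Diff_singleton_cover:
  assumes "a \<in> A" "b \<in> A" "a \<noteq> b"
  shows "component E A a \<subseteq> component E (A - {b}) a \<union> component E (A - {a}) b"
proof (rule component_minimal)
  fix x y
  assume x: "x \<in> component E (A - {b}) a \<union> component E (A - {a}) b"
    and xy: "x \<in> A" "y \<in> A" "{x, y} \<in> E"
  have "component E (A - {b}) a \<subseteq> A - {b}" "component E (A - {a}) b \<subseteq> A - {a}"
    using assms by (intro component_subset; simp)+
  then show "y \<in> component E (A - {b}) a \<union> component E (A - {a}) b"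
    using x xy component_step[of x E "A - {b}" a y] component_step[of x E "A - {a}" b y]
    by (cases "y = a"; cases "y = b") auto
qed simp

lemma connected_on_iff_component:
  assumes "u \<in> U"
  shows "connected_on E U \<longleftrightarrow> component E U u = U"
proof
  assume "connected_on E U"
  then show "component E U u = U"
    using assms component_subset[OF assms, of E] by (auto simp: connected_on_def component_def)
next
  assume U: "component E U u = U"
  have "component E U v = U" if "v \<in> U" for v using component_eq[of v E U u] that U by simp
  then show "connected_on E U" using assms by (auto simp: connected_on_def component_def)
qed

lemma components_subset: "C \<in> components E U \<Longrightarrow> C \<subseteq> U"
  unfolding components_def using component_subset by fastforce

lemma components_eq_component: "C \<in> components E U \<Longrightarrow> u \<in> C \<Longrightarrow> component E U u = C"
  unfolding components_def using component_eq by fastforce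

lemma component_in_components: "u \<in> U \<Longrightarrow> component E U u \<in> components E U"
  by (simp add: components_def)

lemma components_nonempty: "C \<in> components E U \<Longrightarrow> C \<noteq> {}"
  unfolding components_def using component_refl by fastforce

lemma connected_on_components:
  assumes "C \<in> components E U"
  shows "connected_on E C"
proof -
  obtain u where "u \<in> U" "C = component E U u" using assms by (auto simp: components_def)
  then show ?thesis using connected_on_iff_component[of u C E] component_component[of u U E] by simp
qed

section \<open>Elimination orders\<close>

definition tube :: "'a set set \<Rightarrow> 'a set \<Rightarrow> ('a \<Rightarrow> nat) \<Rightarrow> 'a \<Rightarrow> 'a set" where
  "tube E V f u = component E {w \<in> V. f u \<le> f w} u"

definition arcs :: "'a set \<Rightarrow> ('a \<Rightarrow> 'a set) \<Rightarrow> 'a rel" where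
  "arcs V S = {(u, v). u \<in> V \<and> v \<in> S u - {u} \<and> (\<forall>w\<in>V. v \<in> S w - {w} \<longrightarrow> u \<in> S w)}"

definition order_forest :: "'a set set \<Rightarrow> 'a set \<Rightarrow> ('a \<Rightarrow> nat) \<Rightarrow> 'a rel" where
  "order_forest E V f = arcs V (tube E V f)"

lemma arcs_cong: "(\<And>u. u \<in> V \<Longrightarrow> S u = S' u) \<Longrightarrow> arcs V S = arcs V S'"
  by (auto simp: arcs_def)

lemma order_forest_cong:
  "(\<And>u. u \<in> V \<Longrightarrow> tube E V f u = tube E V g u) \<Longrightarrow> order_forest E V f = order_forest E V g"
  unfolding order_forest_def by (rule arcs_cong)

lemma tube_refl [simp]: "u \<in> tube E V f u"
  by (simp add: tube_def)

lemma tube_subset: "u \<in> V \<Longrightarrow> tube E V f u \<subseteq> {w \<in> V. f u \<le> f w}"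
  unfolding tube_def by (rule component_subset) simp

lemma tube_connected: "u \<in> V \<Longrightarrow> component E (tube E V f u) u = tube E V f u"
  unfolding tube_def by (rule component_component) simp

lemma tube_subset_component: "tube E V f u \<subseteq> component E V u"
  unfolding tube_def by (rule component_mono) blast

locale elimination_order =
  fixes E :: "'a set set" and V :: "'a set" and f :: "'a \<Rightarrow> nat"
  assumes finite: "finite V" and inj: "inj_on f V"
begin

lemma tube_less: "u \<in> V \<Longrightarrow> v \<in> tube E V f u \<Longrightarrow> v \<noteq> u \<Longrightarrow> f u < f v"
  using tube_subset[of u V E f] inj_onD[OF inj, of u v] by fastforce

lemma tube_mono:
  assumes "u \<in> V" "v \<in> tube E V f u"
  shows "tube E V f v \<subseteq> tube E V f u"
proof -
  have "f u \<le> f v" using assms tube_subset[of u V E f] by blast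
  then have "tube E V f v \<subseteq> component E {w \<in> V. f u \<le> f w} v"
    unfolding tube_def by (intro component_mono) auto
  also have "\<dots> = tube E V f u" using assms(2) component_eq unfolding tube_def by metis
  finally show ?thesis .
qed

lemma tube_antisym: "u \<in> V \<Longrightarrow> v \<in> V \<Longrightarrow> v \<in> tube E V f u \<Longrightarrow> u \<in> tube E V f v \<Longrightarrow> u = v"
  using tube_less[of u v] tube_less[of v u] by force

lemma tube_chain:
  assumes "u \<in> V" "v \<in> V" "x \<in> tube E V f u" "x \<in> tube E V f v" "f u \<le> f v"
  shows "v \<in> tube E V f u"
proof -
  let ?A = "{w \<in> V. f u \<le> f w}"
  have "tube E V f v \<subseteq> component E ?A v"
    unfolding tube_def using assms(5) by (intro component_mono) auto
  then have "component E ?A x = component E ?A v" using assms(4) by (intro component_eq) blast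
  moreover have "component E ?A x = component E ?A u"
    using assms(3) by (intro component_eq) (simp add: tube_def)
  ultimately show ?thesis using component_refl[of v E ?A] by (simp add: tube_def)
qed

lemma edge_in_tube: "x \<in> V \<Longrightarrow> y \<in> V \<Longrightarrow> {x, y} \<in> E \<Longrightarrow> f x \<le> f y \<Longrightarrow> y \<in> tube E V f x"
  unfolding tube_def by (rule component_step) auto

lemma order_forest_iff:
  "(u, v) \<in> order_forest E V f \<longleftrightarrow>
     u \<in> V \<and> v \<in> tube E V f u \<and> v \<noteq> u \<and> (\<forall>w\<in>V. v \<in> tube E V f w \<longrightarrow> w = v \<or> f w \<le> f u)"
proof -
  have "u \<in> tube E V f w \<longleftrightarrow> f w \<le> f u"
    if "u \<in> V" "w \<in> V" "v \<in> tube E V f u" "v \<in> tube E V f w" for w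
    using tube_chain[of w u v] tube_subset[of w V E f] that by blast
  then show ?thesis unfolding order_forest_def arcs_def by blast
qed

lemma order_forestD:
  assumes "(u, v) \<in> order_forest E V f"
  shows "u \<in> V" "v \<in> V" "v \<in> tube E V f u" "u \<noteq> v" "f u < f v" "u \<notin> tube E V f v"
proof -
  show "u \<in> V" "v \<in> tube E V f u" "u \<noteq> v" using assms by (auto simp: order_forest_iff)
  then show "v \<in> V" "f u < f v" using tube_subset[of u V E f] tube_less[of u v] by auto
  then show "u \<notin> tube E V f v" using tube_subset[of v V E f] by auto
qed

lemma order_forest_subset: "order_forest E V f \<subseteq> V \<times> V"
  using order_forestD by auto

lemma arc_if_successive:
  assumes "u \<in> V" "v \<in> tube E V f u" "f v = Suc (f u)"
  shows "(u, v) \<in> order_forest E V f"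
proof -
  have "w = v \<or> f w \<le> f u" if "w \<in> V" "v \<in> tube E V f w" for w
    using tube_less[OF that] assms(3) by force
  then show ?thesis using assms by (auto simp: order_forest_iff)
qed

lemma parent_unique:
  assumes "(u, v) \<in> order_forest E V f" "(w, v) \<in> order_forest E V f"
  shows "u = w"
proof -
  note u = order_forestD[OF assms(1)] and w = order_forestD[OF assms(2)]
  have "f u \<le> f w" "f w \<le> f u" using assms u w unfolding order_forest_iff by blast+
  then show ?thesis using inj_onD[OF inj, of u w] u(1) w(1) by simp
qed

lemma parent_exists:
  assumes "u \<in> V" "v \<in> tube E V f u" "v \<noteq> u"
  obtains p where "(p, v) \<in> order_forest E V f" "p \<in> tube E V f u"
proof -
  let ?A = "{w \<in> V. v \<in> tube E V f w \<and> w \<noteq> v}"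
  have "finite ?A" "?A \<noteq> {}" using finite assms by auto
  then obtain p where p: "p \<in> ?A" "Max (f ` ?A) = f p" by (rule obtains_MAX)
  have latest: "f w \<le> f p" if "w \<in> ?A" for w
    using Max_ge[of "f ` ?A" "f w"] \<open>finite ?A\<close> that p(2) by simp
  show ?thesis
  proof
    show "(p, v) \<in> order_forest E V f" using p(1) latest by (auto simp: order_forest_iff)
    show "p \<in> tube E V f u" using tube_chain[of u p v] latest[of u] p(1) assms by auto
  qed
qed

lemma subtree_order_forest:
  assumes "u \<in> V"
  shows "subtree (order_forest E V f) u = tube E V f u"
proof
  have "v \<in> tube E V f u" if "(u, v) \<in> (order_forest E V f)\<^sup>*" for v
    using that
    by (induction rule: rtrancl_induct) (use tube_mono assms in \<open>auto simp: order_forest_iff\<close>)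
  then show "subtree (order_forest E V f) u \<subseteq> tube E V f u" by (auto simp: subtree_def)
  have "(u, v) \<in> (order_forest E V f)\<^sup>*" if "v \<in> tube E V f u" for v
    using that
  proof (induction "f v" arbitrary: v rule: less_induct)
    case less
    show ?case
    proof (cases "v = u")
      case False
      with less.prems obtain p where p: "(p, v) \<in> order_forest E V f" "p \<in> tube E V f u"
        using parent_exists assms by blast
      then have "(u, p) \<in> (order_forest E V f)\<^sup>*" using less.hyps order_forestD(5) by blast
      then show ?thesis using p(1) by (rule rtrancl_into_rtrancl)
    qed simp
  qed
  then show "tube E V f u \<subseteq> subtree (order_forest E V f) u" by (auto simp: subtree_def)
qed

lemma child_exists:
  assumes "u \<in> V" "v \<in> tube E V f u" "v \<noteq> u"
  obtains q where "(u, q) \<in> order_forest E V f"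
proof -
  have "(u, v) \<in> (order_forest E V f)\<^sup>*"
    using subtree_order_forest[OF assms(1)] assms(2) by (auto simp: subtree_def)
  then show thesis using assms(3) that by (cases rule: converse_rtranclE) auto
qed

lemma tube_linear_extension:
  assumes ext: "\<And>x y. x \<in> V \<Longrightarrow> y \<in> tube E V f x \<Longrightarrow> y \<noteq> x \<Longrightarrow> g x < g y" and u: "u \<in> V"
  shows "tube E V g u = tube E V f u"
proof
  have "tube E V f u \<subseteq> {w \<in> V. g u \<le> g w}" using tube_subset[OF u, of E f] ext[OF u] by fastforce
  then show "tube E V f u \<subseteq> tube E V g u"
    using component_mono tube_connected[OF u, of E f] unfolding tube_def[of E V g] by metis
  show "tube E V g u \<subseteq> tube E V f u"
    unfolding tube_def[of E V g]
  proof (rule component_minimal)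
    fix x y
    assume x: "x \<in> tube E V f u" and y: "y \<in> {w \<in> V. g u \<le> g w}" and xy: "{x, y} \<in> E"
    have xV: "x \<in> V" using x tube_subset[OF u, of E f] by blast
    have yV: "y \<in> V" using y by blast
    consider (below) "y \<in> tube E V f x" | (above) "x \<in> tube E V f y"
      using edge_in_tube[of x y] edge_in_tube[of y x] xV yV xy by (metis insert_commute linear)
    then show "y \<in> tube E V f u"
    proof cases
      case below
      then show ?thesis using tube_mono[OF u x] by blast
    next
      case above
      then have "y \<in> tube E V f u \<or> u \<in> tube E V f y"
        using tube_chain[OF u yV x] tube_chain[OF yV u _ x] by linarith
      then show ?thesis using ext[OF yV, of u] y by force
    qed
  qed simp
qed

lemma order_forest_linear_extension:
  assumes "\<And>x y. x \<in> V \<Longrightarrow> y \<in> tube E V f x \<Longrightarrow> y \<noteq> x \<Longrightarrow> g x < g y"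
  shows "order_forest E V g = order_forest E V f"
  using assms by (intro order_forest_cong tube_linear_extension)

lemma order_forest_strict_mono:
  assumes "\<And>x y. x \<in> V \<Longrightarrow> y \<in> V \<Longrightarrow> f x < f y \<Longrightarrow> g x < g y"
  shows "order_forest E V g = order_forest E V f"
proof (rule order_forest_linear_extension)
  fix x y assume x: "x \<in> V" and y: "y \<in> tube E V f x" "y \<noteq> x"
  have "y \<in> V" using tube_subset[OF x] y(1) by blast
  then show "g x < g y" using assms[OF x] tube_less[OF x y] by blast
qed

end

lemma order_forest_eq_imp_tube_eq:
  assumes "elimination_order V f" "elimination_order V g" "order_forest E V f = order_forest E V g"
    and "u \<in> V"
  shows "tube E V f u = tube E V g u"
  using assms elimination_order.subtree_order_forest by metis

lemma elimination_order_subset: "elimination_order V f \<Longrightarrow> W \<subseteq> V \<Longrightarrow> elimination_order W f"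
  unfolding elimination_order_def using finite_subset inj_on_subset by metis

section \<open>Rotations as transpositions of consecutive vertices\<close>

definition consecutive :: "'a set \<Rightarrow> ('a \<Rightarrow> nat) \<Rightarrow> 'a \<Rightarrow> 'a \<Rightarrow> bool" where
  "consecutive V f i j \<longleftrightarrow>
     i \<in> V \<and> j \<in> V \<and> i \<noteq> j \<and> (\<forall>w\<in>V - {i, j}. f w < f i \<longleftrightarrow> f w < f j)"

lemma consecutive_commute: "consecutive V f i j \<longleftrightarrow> consecutive V f j i"
  by (auto simp: consecutive_def insert_commute)

lemma consecutive_transpose: "consecutive V f i j \<Longrightarrow> consecutive V (f \<circ> transpose i j) i j"
  by (auto simp: consecutive_def)

lemma consecutive_subset:
  "consecutive V f i j \<Longrightarrow> W \<subseteq> V \<Longrightarrow> i \<in> W \<Longrightarrow> j \<in> W \<Longrightarrow> consecutive W f i j"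
  by (auto simp: consecutive_def)

context elimination_order
begin

lemma elimination_order_transpose: "i \<in> V \<Longrightarrow> j \<in> V \<Longrightarrow> elimination_order V (f \<circ> transpose i j)"
  using finite inj by unfold_locales (simp_all add: comp_inj_on)

lemma consecutive_below_or_above:
  assumes "consecutive V f i j" "w \<in> V" "w \<noteq> i" "w \<noteq> j"
  shows "f w < f i \<and> f w < f j \<or> f i < f w \<and> f j < f w"
proof -
  have "f w \<noteq> f i" "f w \<noteq> f j" "f w < f i \<longleftrightarrow> f w < f j"
    using assms inj_onD[OF inj] unfolding consecutive_def by blast+
  then show ?thesis by linarith
qed

lemma order_forest_transpose_unrelated:
  assumes cons: "consecutive V f i j" and "f i < f j" "j \<notin> tube E V f i"
  shows "order_forest E V (f \<circ> transpose i j) = order_forest E V f"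
proof (rule order_forest_linear_extension)
  fix x y assume "x \<in> V" "y \<in> tube E V f x" "y \<noteq> x"
  then have "f x < f y" "y \<in> V" "\<not> (x = i \<and> y = j)"
    using tube_less[of x y] tube_subset[of x V E f] assms(3) by auto
  then show "(f \<circ> transpose i j) x < (f \<circ> transpose i j) y"
    using consecutive_below_or_above[OF cons \<open>x \<in> V\<close>] consecutive_below_or_above[OF cons \<open>y \<in> V\<close>]
      assms(2)
    by (cases "x = i"; cases "x = j"; cases "y = i"; cases "y = j") auto
qed

text \<open>
  Eliminating \<open>i\<close>, \<open>j\<close> and the rest of the subtree of \<open>i\<close> after everything else does not change
  the forest.
\<close>

lemma arc_imp_consecutive_order:
  assumes arc: "(i, j) \<in> order_forest E V f"
  obtains g where "elimination_order V g" "order_forest E V g = order_forest E V f"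
    "consecutive V g i j" "g i < g j"
proof -
  note ij = order_forestD[OF arc]
  define M where "M = Suc (Max (f ` V))"
  have M: "f w < M" if "w \<in> V" for w
    using finite that by (simp add: M_def less_Suc_eq_le)
  define g where "g w = (if w = i then M else if w = j then M + 1
    else if w \<in> tube E V f i then M + 2 + f w else f w)" for w
  have "inj_on g V"
    using inj M ij by (fastforce simp: inj_on_def g_def split: if_splits)
  then have g: "elimination_order V g" using finite by unfold_locales
  have "order_forest E V g = order_forest E V f"
  proof (rule order_forest_linear_extension)
    fix x y assume x: "x \<in> V" "y \<in> tube E V f x" "y \<noteq> x"
    have less: "f x < f y" and y: "y \<in> V" using tube_less x tube_subset[of x V E f] by auto
    have "y \<in> tube E V f i" if "x \<in> tube E V f i" using tube_mono[OF ij(1) that] x by blast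
    moreover have "\<not> (x \<in> tube E V f i \<and> y = i)" using tube_antisym[of x i] x ij by blast
    moreover have "f x \<le> f i" if "y = j"
      using arc that x by (auto simp: order_forest_iff)
    then have "x = i" if "x \<in> tube E V f i" "y = j"
      using tube_less[OF ij(1) that(1)] that(2) by force
    ultimately show "g x < g y" using less M[OF x(1)] M[OF y] x ij by (auto simp: g_def)
  qed
  moreover have "consecutive V g i j" using M ij by (force simp: consecutive_def g_def)
  moreover have "g i < g j" using ij by (simp add: g_def)
  ultimately show thesis using that g by blast
qed

end

locale rotatable_pair = elimination_order +
  fixes i j
  assumes cons: "consecutive V f i j" and less: "f i < f j" and in_tube: "j \<in> tube E V f i"
begin

abbreviation swapped :: "'a \<Rightarrow> nat" where
  "swapped \<equiv> f \<circ> transpose i j"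

abbreviation lower_tube :: "'a set" where
  "lower_tube \<equiv> component E (tube E V f i - {j}) i"

lemma vertices: "i \<in> V" "j \<in> V" "i \<noteq> j"
  using cons by (auto simp: consecutive_def)

interpretation swapped: elimination_order E V swapped
  using elimination_order_transpose vertices by blast

lemma below_or_above: "w \<in> V \<Longrightarrow> w \<noteq> i \<Longrightarrow> w \<noteq> j \<Longrightarrow> f w < f i \<and> f w < f j \<or> f i < f w \<and> f j < f w"
  using consecutive_below_or_above[OF cons] .

lemma lower_tube_subset: "lower_tube \<subseteq> tube E V f i - {j}"
  using vertices by (intro component_subset) simp

lemma arc: "(i, j) \<in> order_forest E V f"
proof -
  have "f w \<le> f i" if "w \<in> V" "j \<in> tube E V f w" "w \<noteq> j" for w
    using tube_less[OF that(1,2)] below_or_above[OF that(1)] that(3) by (cases "w = i") auto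
  then show ?thesis using vertices in_tube by (auto simp: order_forest_iff)
qed

lemma component_upper: "component E {w \<in> V. f i \<le> f w} j = tube E V f i"
  using component_eq in_tube unfolding tube_def by metis

lemma tube_lower: "tube E V f j = component E (tube E V f i - {i}) j"
proof -
  let ?U = "{w \<in> V. f i \<le> f w}"
  have "f j \<le> f w \<longleftrightarrow> f i \<le> f w \<and> w \<noteq> i" if "w \<in> V" for w
    using less below_or_above[OF that] by (cases "w = i"; cases "w = j") auto
  then have "{w \<in> V. f j \<le> f w} = ?U - {i}" by blast
  then have "tube E V f j = component E (?U - {i}) j" by (simp add: tube_def)
  also have "\<dots> = component E (component E ?U j - {i}) j"
    using vertices less by (intro component_component_Diff[symmetric]) auto
  finally show ?thesis unfolding component_upper .
qed

lemma tube_swapped_upper [simp]: "tube E V swapped j = tube E V f i"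
proof -
  have "swapped j \<le> swapped w \<longleftrightarrow> f i \<le> f w" for w
    using vertices less by (cases "w = i"; cases "w = j") auto
  then show ?thesis using component_upper by (simp add: tube_def)
qed

lemma tube_swapped_lower [simp]: "tube E V swapped i = lower_tube"
proof -
  let ?U = "{w \<in> V. f i \<le> f w}"
  have "swapped i \<le> swapped w \<longleftrightarrow> f i \<le> f w \<and> w \<noteq> j" if "w \<in> V" for w
    using vertices less below_or_above[OF that] by (cases "w = i"; cases "w = j") auto
  then have "{w \<in> V. swapped i \<le> swapped w} = ?U - {j}" by auto
  then have "tube E V swapped i = component E (?U - {j}) i" by (simp add: tube_def)
  also have "\<dots> = lower_tube"
    unfolding tube_def using vertices by (intro component_component_Diff[symmetric]) auto
  finally show ?thesis .
qed

lemma tube_swapped_other [simp]: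
  assumes "u \<in> V" "u \<noteq> i" "u \<noteq> j"
  shows "tube E V swapped u = tube E V f u"
proof -
  have "swapped u \<le> swapped w \<longleftrightarrow> f u \<le> f w" for w
    using below_or_above[OF assms] assms by (cases "w = i"; cases "w = j") auto
  then show ?thesis by (simp add: tube_def)
qed

lemma rotatable_pair_swapped: "rotatable_pair E V swapped j i"
  using consecutive_transpose[OF cons] less vertices
  by unfold_locales (simp_all add: consecutive_commute)

lemma order_forest_swapped_neq: "order_forest E V swapped \<noteq> order_forest E V f"
proof
  assume "order_forest E V swapped = order_forest E V f"
  then have "(j, i) \<in> order_forest E V f"
    using rotatable_pair.arc[OF rotatable_pair_swapped] by simp
  then show False using order_forestD(5)[of j i] less by simp
qed

lemma moved_iff:
  "k \<in> moved E (order_forest E V f) i j \<longleftrightarrow> (j, k) \<in> order_forest E V f \<and> k \<in> lower_tube"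
proof -
  have "tube E V f k \<subseteq> lower_tube \<longleftrightarrow> k \<in> lower_tube" if "(j, k) \<in> order_forest E V f"
  proof -
    have k: "k \<noteq> i" "k \<noteq> j" "k \<in> V" using order_forestD[OF that] less by auto
    show ?thesis using swapped.tube_mono[OF vertices(1), of k] tube_refl[of k E V f] k by auto
  qed
  then show ?thesis using subtree_order_forest vertices order_forestD by (auto simp: moved_def)
qed

lemma moved_imp_swapped_arc:
  assumes "k \<in> moved E (order_forest E V f) i j"
  shows "(i, k) \<in> order_forest E V swapped"
proof -
  have jk: "(j, k) \<in> order_forest E V f" and k: "k \<in> lower_tube" using assms moved_iff by auto
  have "w = k \<or> swapped w \<le> f j" if w: "w \<in> V" "k \<in> tube E V swapped w" for w
    using jk w less by (cases "w = i"; cases "w = j") (auto simp: order_forest_iff)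
  moreover have "k \<noteq> i" using order_forestD[OF jk] less by auto
  ultimately show ?thesis using k vertices by (auto simp: swapped.order_forest_iff)
qed

lemma parent_arc_imp_swapped_arc:
  assumes p: "(p, i) \<in> order_forest E V f"
  shows "(p, j) \<in> order_forest E V swapped"
proof -
  note parent = order_forestD[OF p]
  have "p \<noteq> j" using parent less by auto
  have "j \<in> tube E V swapped p" using tube_mono[OF parent(1,3)] in_tube parent \<open>p \<noteq> j\<close> by auto
  moreover have "w = j \<or> swapped w \<le> swapped p" if w: "w \<in> V" "j \<in> tube E V swapped w" for w
  proof (cases "w = i \<or> w = j")
    case True
    then show ?thesis using w(2) lower_tube_subset by auto
  next
    case False
    then have "j \<in> tube E V f w" using w by simp
    moreover from this have "f w \<le> f i"
      using tube_less[OF w(1)] below_or_above[OF w(1)] False by force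
    ultimately have "i \<in> tube E V f w" using tube_chain[OF w(1) vertices(1) _ in_tube] by blast
    then show ?thesis using p w(1) False parent \<open>p \<noteq> j\<close> by (auto simp: order_forest_iff)
  qed
  ultimately show ?thesis using parent(1) \<open>p \<noteq> j\<close> by (auto simp: swapped.order_forest_iff)
qed

lemma unmoved_arc_imp_swapped_arc:
  assumes p: "(p, k) \<in> order_forest E V f"
    and k: "k \<noteq> i" "k \<noteq> j" "k \<notin> moved E (order_forest E V f) i j"
  shows "(p, k) \<in> order_forest E V swapped"
proof -
  note parent = order_forestD[OF p]
  have last: "w = k \<or> f w \<le> f p" if "w \<in> V" "k \<in> tube E V f w" for w
    using p that by (auto simp: order_forest_iff)
  consider (upper) "p = i" | (lower) "p = j" | (other) "p \<noteq> i" "p \<noteq> j" by blast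
  then show ?thesis
  proof cases
    case upper
    have "k \<in> component E (tube E V f i) i"
      using parent upper tube_connected[OF vertices(1), of E f] by simp
    then have "k \<in> lower_tube \<union> tube E V f j"
      using component_Diff_singleton_cover[of i "tube E V f i" j E] in_tube vertices tube_lower
      by auto
    moreover have "k \<notin> tube E V f j" using last[of j] vertices k less upper by auto
    ultimately have "k \<in> lower_tube" by blast
    moreover have "w = k \<or> swapped w \<le> f j" if "w \<in> V" "k \<in> tube E V swapped w" for w
      using last[of w] that less upper by (cases "w = i"; cases "w = j") auto
    ultimately show ?thesis using upper vertices k by (auto simp: swapped.order_forest_iff)
  next
    case lower
    then have "k \<notin> lower_tube" using k(3) p moved_iff by blast
    then have "w = k \<or> swapped w \<le> f i" if "w \<in> V" "k \<in> tube E V swapped w" for w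
      using last[of w] below_or_above[of w] that vertices lower
      by (cases "w = i"; cases "w = j") auto
    moreover have "k \<in> tube E V f i" using parent lower tube_mono[OF vertices(1) in_tube] by blast
    ultimately show ?thesis using lower vertices k by (auto simp: swapped.order_forest_iff)
  next
    case other
    have "f i < f p \<and> f j < f p" if "k \<in> tube E V f i"
      using last[OF vertices(1) that] below_or_above[OF parent(1) other] k by auto
    then have "w = k \<or> swapped w \<le> f p" if "w \<in> V" "k \<in> tube E V swapped w" for w
      using last[of w] that lower_tube_subset by (cases "w = i"; cases "w = j") auto
    then show ?thesis using parent other by (auto simp: swapped.order_forest_iff)
  qed
qed

lemma swapped_arc_imp_parent:
  assumes ab: "(a, b) \<in> order_forest E V swapped" and "b \<noteq> i"
  obtains c where "(c, if b = j then i else b) \<in> order_forest E V f"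
proof (cases "b = j")
  case True
  note a = swapped.order_forestD[OF ab]
  have "a \<noteq> i" "a \<noteq> j" using a True lower_tube_subset by auto
  then have "j \<in> tube E V f a" "f a < f i" using a True by auto
  then have "i \<in> tube E V f a" using tube_chain[OF a(1) vertices(1) _ in_tube] by simp
  then show thesis using parent_exists[OF a(1)] \<open>a \<noteq> i\<close> that True by auto
next
  case False
  note a = swapped.order_forestD[OF ab]
  have "b \<in> tube E V f i \<or> a \<noteq> i \<and> a \<noteq> j \<and> b \<in> tube E V f a"
    using a lower_tube_subset by (cases "a = i"; cases "a = j") auto
  then show thesis
    using parent_exists[OF vertices(1), of b] parent_exists[OF a(1), of b] a(4) assms(2) that False
    by auto
qed

lemma rotation_eq_swapped: "rotation E (order_forest E V f) i j = order_forest E V swapped"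
    (is "?R = ?G")
proof
  show R: "?R \<subseteq> ?G"
    using unmoved_arc_imp_swapped_arc parent_arc_imp_swapped_arc moved_imp_swapped_arc
      rotatable_pair.arc[OF rotatable_pair_swapped]
    by (auto simp: rotation_def)
  show "?G \<subseteq> ?R"
  proof clarify
    fix a b assume ab: "(a, b) \<in> ?G"
    have "\<exists>c. (c, b) \<in> ?R"
    proof (cases "b = i")
      case False
      then obtain c where "(c, if b = j then i else b) \<in> order_forest E V f"
        using swapped_arc_imp_parent[OF ab] by blast
      then show ?thesis using False by (cases "b = j") (auto simp: rotation_def)
    qed (auto simp: rotation_def)
    then obtain c where "(c, b) \<in> ?R" by blast
    then show "(a, b) \<in> ?R" using R swapped.parent_unique[OF ab, of c] by blast
  qed
qed

end

section \<open>Elimination forests are the forests of elimination orders\<close>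

lemma tube_component:
  assumes "C \<in> components E V" "u \<in> C"
  shows "tube E C f u = tube E V f u"
proof -
  have C: "component E V u = C" "C \<subseteq> V"
    using components_eq_component[OF assms] components_subset[OF assms(1)] .
  then have "component E {w \<in> V. f u \<le> f w} u \<subseteq> {w \<in> C. f u \<le> f w}"
    using assms tube_subset_component[of E V f u] tube_subset[of u V E f]
    by (auto simp: tube_def)
  then show ?thesis unfolding tube_def using C by (intro component_absorb) auto
qed

lemma order_forest_component:
  assumes C: "C \<in> components E V" and u: "u \<in> C"
  shows "(u, v) \<in> order_forest E V f \<longleftrightarrow> (u, v) \<in> order_forest E C f"
proof -
  have "w \<in> C" if "w \<in> V" "v \<in> tube E V f w" "v \<in> tube E V f u" for w
  proof -
    have "v \<in> component E V w" "v \<in> component E V u"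
      using that tube_subset_component[of E V f] by auto
    then have "component E V w = C" using component_eq components_eq_component[OF C u] by metis
    then show ?thesis using component_refl by metis
  qed
  then show ?thesis
    using u components_subset[OF C] tube_component[OF C, of _ f]
    unfolding order_forest_def arcs_def by auto
qed

lemma order_forest_components: "order_forest E V f = (\<Union>C\<in>components E V. order_forest E C f)"
proof -
  have "(u, v) \<in> order_forest E V f \<longleftrightarrow> (\<exists>C\<in>components E V. (u, v) \<in> order_forest E C f)" for u v
  proof
    assume uv: "(u, v) \<in> order_forest E V f"
    then have "component E V u \<in> components E V"
      by (intro component_in_components) (simp add: order_forest_def arcs_def)
    then show "\<exists>C\<in>components E V. (u, v) \<in> order_forest E C f"
      using uv order_forest_component component_refl by metis
  next
    assume "\<exists>C\<in>components E V. (u, v) \<in> order_forest E C f"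
    then obtain C where C: "C \<in> components E V" "(u, v) \<in> order_forest E C f" by blast
    then have "u \<in> C" by (simp add: order_forest_def arcs_def)
    then show "(u, v) \<in> order_forest E V f" using order_forest_component C by metis
  qed
  then show ?thesis by auto
qed

lemma tube_Diff_singleton: "f x < f u \<Longrightarrow> tube E (V - {x}) f u = tube E V f u"
  unfolding tube_def by (rule arg_cong[where f = "\<lambda>A. component E A u"]) auto

lemma tube_first:
  assumes "u \<in> V" "is_arg_min f (\<lambda>y. y \<in> component E V u) u"
  shows "tube E V f u = component E V u"
  unfolding tube_def using assms component_subset[of u V E]
  by (intro component_absorb) (auto simp: is_arg_min_linorder)

definition roots :: "'a set set \<Rightarrow> 'a set \<Rightarrow> ('a \<Rightarrow> nat) \<Rightarrow> 'a set" where
  "roots E V f = {v \<in> V. \<forall>w\<in>V. v \<in> tube E V f w \<longrightarrow> w = v}"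

context elimination_order
begin

lemma first_less: "is_arg_min f (\<lambda>y. y \<in> V) x \<Longrightarrow> y \<in> V \<Longrightarrow> y \<noteq> x \<Longrightarrow> f x < f y"
  using inj_onD[OF inj, of x y] by (fastforce simp: is_arg_min_linorder)

lemma first_strict_mono:
  fixes g :: "'a \<Rightarrow> 'b::linorder"
  assumes x: "is_arg_min f (\<lambda>y. y \<in> V) x"
    and mono: "\<And>x y. x \<in> V \<Longrightarrow> y \<in> V \<Longrightarrow> f x < f y \<Longrightarrow> g x < g y"
  shows "is_arg_min g (\<lambda>y. y \<in> V) x"
proof -
  have "x \<in> V" using x by (simp add: is_arg_min_def)
  then have "g x \<le> g y" if "y \<in> V" for y
    using mono[of x y] first_less[OF x that] that by (cases "y = x") auto
  then show ?thesis using \<open>x \<in> V\<close> by (simp add: is_arg_min_linorder)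
qed

lemma root_iff_first: "v \<in> roots E V f \<longleftrightarrow> v \<in> V \<and> is_arg_min f (\<lambda>y. y \<in> component E V v) v"
proof (cases "v \<in> V")
  case True
  let ?C = "component E V v"
  have C: "?C \<subseteq> V" using True by (rule component_subset)
  show ?thesis
  proof
    assume v: "v \<in> roots E V f"
    have "finite ?C" using C finite by (rule finite_subset)
    then obtain m where m: "is_arg_min f (\<lambda>y. y \<in> ?C) m"
      using ex_is_arg_min_if_finite[of ?C f] component_refl[of v E V] by blast
    then have m_in: "m \<in> ?C" by (simp add: is_arg_min_def)
    then have "component E V m = ?C" by (rule component_eq)
    then have "tube E V f m = ?C" using tube_first[of m V f E] m m_in C by auto
    then have "v \<in> tube E V f m" by simp
    then have "m = v" using v m_in C by (auto simp: roots_def)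
    then show "v \<in> V \<and> is_arg_min f (\<lambda>y. y \<in> ?C) v" using m True by simp
  next
    assume v: "v \<in> V \<and> is_arg_min f (\<lambda>y. y \<in> ?C) v"
    have "w = v" if w: "w \<in> V" "v \<in> tube E V f w" for w
    proof -
      have "v \<in> component E V w" using tube_subset_component[of E V f w] w(2) by blast
      then have "w \<in> ?C" using component_eq component_refl by metis
      then have "f v \<le> f w" using v by (auto simp: is_arg_min_linorder)
      then show ?thesis using tube_less[OF w] by force
    qed
    then show "v \<in> roots E V f" using v by (simp add: roots_def)
  qed
qed (simp add: roots_def)

lemma order_forest_remove_root:
  assumes V: "connected_on E V" and x: "is_arg_min f (\<lambda>y. y \<in> V) x"
  shows "order_forest E V f = Pair x ` roots E (V - {x}) f \<union> order_forest E (V - {x}) f"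
proof -
  have xV: "x \<in> V" using x by (simp add: is_arg_min_def)
  then have "component E V x = V" using V by (simp add: connected_on_iff_component)
  then have top: "tube E V f x = V" using tube_first[OF xV, of f E] x by simp
  let ?S = "tube E V f"
  have rest: "tube E (V - {x}) f u = ?S u" "x \<notin> ?S u" if "u \<in> V" "u \<noteq> x" for u
    using first_less[OF x that] tube_Diff_singleton[of f x u E V] tube_subset[of u V E f] that
    by auto
  have "roots E (V - {x}) f = {v \<in> V - {x}. \<forall>w\<in>V - {x}. v \<in> ?S w \<longrightarrow> w = v}"
    using rest(1) by (auto simp: roots_def)
  moreover have "order_forest E (V - {x}) f = arcs (V - {x}) ?S"
    unfolding order_forest_def using rest(1) by (intro arcs_cong) auto
  moreover have "arcs V ?S =
      Pair x ` {v \<in> V - {x}. \<forall>w\<in>V - {x}. v \<in> ?S w \<longrightarrow> w = v} \<union> arcs (V - {x}) ?S"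
    using rest(2) top xV unfolding arcs_def by (auto, blast+)
  ultimately show ?thesis by (simp add: order_forest_def)
qed

lemma order_forest_root:
  assumes V: "connected_on E V" and x: "is_arg_min f (\<lambda>y. y \<in> V) x"
    and r: "\<And>C. C \<in> components E (V - {x}) \<Longrightarrow> is_arg_min f (\<lambda>y. y \<in> C) (r C)"
  shows "order_forest E V f = (\<Union>C\<in>components E (V - {x}). insert (x, r C) (order_forest E C f))"
proof -
  let ?W = "V - {x}"
  interpret W: elimination_order E ?W f
    using finite inj by unfold_locales (auto intro: inj_on_subset)
  have "v \<in> roots E ?W f \<longleftrightarrow> (\<exists>C\<in>components E ?W. v = r C)" for v
  proof
    assume "v \<in> roots E ?W f"
    then have v: "v \<in> ?W" "is_arg_min f (\<lambda>y. y \<in> component E ?W v) v"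
      using W.root_iff_first by auto
    have C: "component E ?W v \<in> components E ?W" using component_in_components[OF v(1)] .
    then have "f v = f (r (component E ?W v))" "r (component E ?W v) \<in> ?W"
      using v(2) r[OF C] components_subset[OF C]
      by (auto simp: is_arg_min_linorder intro: order_antisym)
    then have "v = r (component E ?W v)" using inj_onD[OF W.inj] v(1) by blast
    then show "\<exists>C\<in>components E ?W. v = r C" using C by blast
  next
    assume "\<exists>C\<in>components E ?W. v = r C"
    then obtain C where C: "C \<in> components E ?W" "v = r C" by blast
    then have "v \<in> C" "is_arg_min f (\<lambda>y. y \<in> C) v" using r by (auto simp: is_arg_min_def)
    then show "v \<in> roots E ?W f"
      using W.root_iff_first components_eq_component[OF C(1)] components_subset[OF C(1)] by auto
  qed
  then have "roots E ?W f = r ` components E ?W" by blast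
  then show ?thesis
    using order_forest_remove_root[OF V x] order_forest_components[of E ?W f] by auto
qed

end

lemma elim_tree_order_forest:
  assumes "elimination_order U f" "connected_on E U" "is_arg_min f (\<lambda>y. y \<in> U) x"
  shows "elim_tree E U x (order_forest E U f)"
  using assms
proof (induction "card U" arbitrary: U x rule: less_induct)
  case less
  interpret elimination_order E U f by (fact less.prems(1))
  have x: "x \<in> U" using less.prems(3) by (simp add: is_arg_min_def)
  define r where "r C = arg_min f (\<lambda>y. y \<in> C)" for C
  have r: "is_arg_min f (\<lambda>y. y \<in> C) (r C)" if "C \<in> components E (U - {x})" for C
    unfolding r_def using components_nonempty[OF that] by (auto intro: is_arg_min_arg_min_nat)
  have "elim_tree E C (r C) (order_forest E C f)" if C: "C \<in> components E (U - {x})" for C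
  proof (rule less.hyps)
    have "C \<subset> U" using components_subset[OF C] x by blast
    then show "card C < card U" "elimination_order C f"
      using finite elimination_order_subset[OF less.prems(1)] by (auto intro: psubset_card_mono)
  qed (use connected_on_components[OF C] r[OF C] in auto)
  then have "elim_tree E U x (\<Union>C\<in>components E (U - {x}). insert (x, r C) (order_forest E C f))"
    using less.prems(2) x by (intro elim_treeI)
  then show ?case using order_forest_root[OF less.prems(2,3), of r] r by simp
qed

lemma glue_component_orders:
  assumes "finite W" and g: "\<And>C. C \<in> components E W \<Longrightarrow> elimination_order C (g C)"
  shows "\<exists>f. elimination_order W f \<and> (\<forall>u. 0 < f u) \<and>
    (\<forall>C\<in>components E W. \<forall>u\<in>C. \<forall>v\<in>C. g C u < g C v \<longrightarrow> f u < f v)"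
proof -
  obtain e and N :: nat where e: "e ` W = {i. i < N}" "inj_on e W"
    using finite_imp_inj_to_nat_seg[OF assms(1)] by metis
  define f where "f u = Suc (N * g (component E W u) u + e u)" for u
  have e_less: "e u < N" if "u \<in> W" for u using e(1) that by blast
  have "inj_on f W"
  proof (rule inj_onI)
    fix u v assume uv: "u \<in> W" "v \<in> W" "f u = f v"
    then have "(f u - 1) mod N = (f v - 1) mod N" by simp
    then have "e u = e v" using e_less uv by (simp add: f_def)
    then show "u = v" using e(2) uv by (simp add: inj_on_def)
  qed
  then have f: "elimination_order W f" using assms(1) by unfold_locales
  have "f u < f v" if C: "C \<in> components E W" "u \<in> C" "v \<in> C" "g C u < g C v" for C u v
  proof -
    have "f u \<le> N * Suc (g C u)"
      using e_less[of u] components_eq_component[OF C(1,2)] components_subset[OF C(1)] C(2)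
      by (auto simp: f_def less_imp_Suc_add)
    also have "\<dots> \<le> N * g C v" using C(4) by (intro mult_le_mono2) simp
    also have "\<dots> < f v" using components_eq_component[OF C(1,3)] by (simp add: f_def)
    finally show ?thesis .
  qed
  then show ?thesis using f by (intro exI[of _ f]) (simp add: f_def)
qed

lemma elim_tree_imp_order:
  assumes "elim_tree E U x T" "finite U"
  shows "\<exists>f. elimination_order U f \<and> is_arg_min f (\<lambda>y. y \<in> U) x \<and> T = order_forest E U f"
  using assms
proof (induction rule: elim_tree.induct)
  case (elim_treeI U x r S)
  let ?W = "U - {x}"
  have "\<exists>g. elimination_order C g \<and> is_arg_min g (\<lambda>y. y \<in> C) (r C) \<and> S C = order_forest E C g"
    if C: "C \<in> components E ?W" for C
    using elim_treeI.IH[OF C] elim_treeI.prems components_subset[OF C] finite_subset by blast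
  then obtain g where g: "\<And>C. C \<in> components E ?W \<Longrightarrow> elimination_order C (g C) \<and>
      is_arg_min (g C) (\<lambda>y. y \<in> C) (r C) \<and> S C = order_forest E C (g C)"
    by metis
  have "finite ?W" using elim_treeI.prems by simp
  then obtain h where h: "elimination_order ?W h" "\<forall>u. 0 < h u"
    "\<forall>C\<in>components E ?W. \<forall>u\<in>C. \<forall>v\<in>C. g C u < g C v \<longrightarrow> h u < h v"
    using glue_component_orders[of ?W E g] g by blast
  define f where "f = h(x := 0)"
  have mono: "f u < f v" if "C \<in> components E ?W" "u \<in> C" "v \<in> C" "g C u < g C v" for C u v
    using h(3) components_subset[OF that(1)] that by (auto simp: f_def)
  have "inj_on f U" using h(1,2) by (fastforce simp: f_def inj_on_def elimination_order_def)
  then have f: "elimination_order U f" using elim_treeI.prems by unfold_locales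
  have x: "is_arg_min f (\<lambda>y. y \<in> U) x"
    using elim_treeI.hyps(2) by (simp add: f_def is_arg_min_def)
  have "order_forest E C f = S C" "is_arg_min f (\<lambda>y. y \<in> C) (r C)" if C: "C \<in> components E ?W" for C
    using g[OF C] mono[OF C] elimination_order.order_forest_strict_mono[of C "g C" f E]
      elimination_order.first_strict_mono[of C "g C" "r C" f] by auto
  then have "(\<Union>C\<in>components E ?W. insert (x, r C) (S C)) = order_forest E U f"
    using elimination_order.order_forest_root[OF f elim_treeI.hyps(1) x, of r] by simp
  then show ?case using f x by blast
qed

lemma elim_forest_iff_order:
  assumes "finite V"
  shows "elim_forest V E F \<longleftrightarrow> (\<exists>f. elimination_order V f \<and> F = order_forest E V f)"
proof
  assume "elim_forest V E F"
  then obtain S where S: "\<And>C. C \<in> components E V \<Longrightarrow> \<exists>x. elim_tree E C x (S C)"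
    and F: "F = (\<Union>C\<in>components E V. S C)"
    unfolding elim_forest_def by blast
  have "\<exists>g. elimination_order C g \<and> S C = order_forest E C g" if "C \<in> components E V" for C
    using S[OF that] elim_tree_imp_order components_subset[OF that] finite_subset assms by metis
  then obtain g where g: "\<And>C. C \<in> components E V \<Longrightarrow>
      elimination_order C (g C) \<and> S C = order_forest E C (g C)"
    by metis
  then obtain f where f: "elimination_order V f"
    "\<forall>C\<in>components E V. \<forall>u\<in>C. \<forall>v\<in>C. g C u < g C v \<longrightarrow> f u < f v"
    using glue_component_orders[OF assms, of E g] by blast
  have "order_forest E C f = order_forest E C (g C)" if C: "C \<in> components E V" for C
    using g[OF C] f(2) C by (intro elimination_order.order_forest_strict_mono) auto
  then show "\<exists>f. elimination_order V f \<and> F = order_forest E V f"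
    using F f(1) g order_forest_components[of E V f] by (intro exI[of _ f]) auto
next
  assume "\<exists>f. elimination_order V f \<and> F = order_forest E V f"
  then obtain f where f: "elimination_order V f" "F = order_forest E V f" by blast
  have "\<exists>x. elim_tree E C x (order_forest E C f)" if C: "C \<in> components E V" for C
  proof -
    have "is_arg_min f (\<lambda>y. y \<in> C) (arg_min f (\<lambda>y. y \<in> C))"
      using components_nonempty[OF C] by (auto intro: is_arg_min_arg_min_nat)
    then show ?thesis
      using elim_tree_order_forest[OF elimination_order_subset[OF f(1) components_subset[OF C]]]
        connected_on_components[OF C] by metis
  qed
  then show "elim_forest V E F"
    unfolding elim_forest_def f(2) using order_forest_components[of E V f]
    by (intro exI[of _ "\<lambda>C. order_forest E C f"]) simp
qed

section \<open>Rotations of a tree edge\<close>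

definition edge_rotations :: "'a set set \<Rightarrow> 'a set \<Rightarrow> 'a \<Rightarrow> 'a \<Rightarrow> 'a rel rel" where
  "edge_rotations E V i j = {(order_forest E V f, order_forest E V (f \<circ> transpose i j)) | f.
     elimination_order V f \<and> consecutive V f i j \<and>
     order_forest E V (f \<circ> transpose i j) \<noteq> order_forest E V f}"

lemma edge_rotationsE:
  assumes "(F, F') \<in> edge_rotations E V i j"
  obtains f where "elimination_order V f" "elimination_order V (f \<circ> transpose i j)"
    "consecutive V f i j" "F = order_forest E V f" "F' = order_forest E V (f \<circ> transpose i j)"
    "F' \<noteq> F"
proof -
  obtain f where f: "elimination_order V f" "consecutive V f i j" "F' \<noteq> F"
    "F = order_forest E V f" "F' = order_forest E V (f \<circ> transpose i j)"
    using assms by (auto simp: edge_rotations_def)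
  moreover from f have "elimination_order V (f \<circ> transpose i j)"
    by (intro elimination_order.elimination_order_transpose) (auto simp: consecutive_def)
  ultimately show thesis using that by blast
qed

lemma edge_rotations_commute: "edge_rotations E V i j = edge_rotations E V j i"
  by (simp add: edge_rotations_def transpose_commute[of i j] consecutive_commute[of V _ i j])

lemma sym_edge_rotations: "sym (edge_rotations E V i j)"
proof (rule symI, erule edge_rotationsE)
  fix F F' and f :: "'a \<Rightarrow> nat"
  let ?g = "f \<circ> transpose i j"
  assume f: "elimination_order V f" "elimination_order V ?g" "consecutive V f i j"
    and F: "F = order_forest E V f" "F' = order_forest E V ?g" "F' \<noteq> F"
  have "f = ?g \<circ> transpose i j" by (simp add: comp_assoc)
  then show "(F', F) \<in> edge_rotations E V i j"
    using f(2) consecutive_transpose[OF f(3)] F unfolding edge_rotations_def by auto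
qed

lemma edge_rotations_imp_elim_forest:
  assumes "finite V" "(F, F') \<in> edge_rotations E V i j"
  shows "elim_forest V E F" "elim_forest V E F'" "i \<in> V" "j \<in> V"
  using assms by (auto elim!: edge_rotationsE simp: elim_forest_iff_order consecutive_def)

lemma edge_rotations_irrefl: "(F, F') \<in> edge_rotations E V i j \<Longrightarrow> i \<noteq> j \<and> F \<noteq> F'"
  by (auto elim!: edge_rotationsE simp: consecutive_def)

lemma transpose_imp_edge_rotation:
  assumes "elimination_order V f" "consecutive V f i j"
  shows "order_forest E V (f \<circ> transpose i j) = order_forest E V f \<or>
    (order_forest E V f, order_forest E V (f \<circ> transpose i j)) \<in> edge_rotations E V i j"
  using assms unfolding edge_rotations_def by blast

lemma (in elimination_order) transpose_eq_rotation:
  assumes "consecutive V f i j" "f i < f j"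
    and neq: "order_forest E V (f \<circ> transpose i j) \<noteq> order_forest E V f"
  shows "(i, j) \<in> order_forest E V f"
    and "order_forest E V (f \<circ> transpose i j) = rotation E (order_forest E V f) i j"
proof -
  have "j \<in> tube E V f i" using order_forest_transpose_unrelated[OF assms(1,2)] neq by blast
  then interpret rotatable_pair E V f i j using assms by unfold_locales
  show "(i, j) \<in> order_forest E V f" by (rule arc)
  show "order_forest E V (f \<circ> transpose i j) = rotation E (order_forest E V f) i j"
    by (rule rotation_eq_swapped[symmetric])
qed

lemma edge_rotations_imp_rotation:
  assumes "(F, F') \<in> edge_rotations E V i j"
  shows "(i, j) \<in> F \<and> F' = rotation E F i j \<or> (j, i) \<in> F \<and> F' = rotation E F j i"
  using assms
proof (rule edge_rotationsE)
  fix f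
  assume f: "elimination_order V f" and cons: "consecutive V f i j"
    and F: "F = order_forest E V f" "F' = order_forest E V (f \<circ> transpose i j)" "F' \<noteq> F"
  interpret elimination_order E V f by (fact f)
  have "f i \<noteq> f j" using cons inj_onD[OF inj] by (auto simp: consecutive_def)
  then consider (less) "f i < f j" | (greater) "f j < f i" by linarith
  then show ?thesis
  proof cases
    case less
    then show ?thesis using transpose_eq_rotation[OF cons] F by simp
  next
    case greater
    have "consecutive V f j i" using cons consecutive_commute by metis
    then show ?thesis
      using transpose_eq_rotation[of j i] greater F by (simp add: transpose_commute[of j i])
  qed
qed

lemma rotation_in_edge_rotations:
  assumes f: "elimination_order V f" and arc: "(i, j) \<in> order_forest E V f"
  shows "(order_forest E V f, rotation E (order_forest E V f) i j) \<in> edge_rotations E V i j"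
proof -
  interpret elimination_order E V f by (fact f)
  obtain g where g: "elimination_order V g" "order_forest E V g = order_forest E V f"
    "consecutive V g i j" "g i < g j"
    using arc_imp_consecutive_order[OF arc] .
  interpret g: elimination_order E V g by (fact g(1))
  interpret rotatable_pair E V g i j
    using g arc g.order_forestD(3) by unfold_locales auto
  show ?thesis
    using g(1,3) order_forest_swapped_neq rotation_eq_swapped g(2)
    unfolding edge_rotations_def by auto
qed

section \<open>Deleting a vertex\<close>

definition forest_del :: "'a set set \<Rightarrow> 'a set \<Rightarrow> 'a \<Rightarrow> 'a rel \<Rightarrow> 'a rel" where
  "forest_del E V n F = arcs (V - {n}) (\<lambda>u. component E (subtree F u - {n}) u)"

lemma component_tube_Diff:
  assumes "u \<in> V" "u \<noteq> n"
  shows "component E (tube E V f u - {n}) u = tube E (V - {n}) f u"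
proof -
  have "component E (tube E V f u - {n}) u = component E ({w \<in> V. f u \<le> f w} - {n}) u"
    unfolding tube_def using assms by (intro component_component_Diff) auto
  also have "{w \<in> V. f u \<le> f w} - {n} = {w \<in> V - {n}. f u \<le> f w}" by blast
  finally show ?thesis by (simp add: tube_def)
qed

lemma forest_del_order_forest:
  assumes "elimination_order V f"
  shows "forest_del E V n (order_forest E V f) = order_forest E (V - {n}) f"
  unfolding forest_del_def order_forest_def[of E "V - {n}"]
  using elimination_order.subtree_order_forest[OF assms] component_tube_Diff
  by (intro arcs_cong) fastforce

lemma elim_forest_forest_del:
  assumes "finite V" "elim_forest V E F"
  shows "elim_forest (V - {n}) E (forest_del E V n F)"
proof -
  obtain f where f: "elimination_order V f" "F = order_forest E V f"
    using assms elim_forest_iff_order by metis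
  have "elimination_order (V - {n}) f" using elimination_order_subset[OF f(1)] by simp
  then show ?thesis
    using assms(1) f(2) forest_del_order_forest[OF f(1)] elim_forest_iff_order[of "V - {n}"] by auto
qed

lemma prepend_order:
  assumes "elimination_order (V - {n}) f" "n \<in> V"
  obtains g where "elimination_order V g" "is_arg_min g (\<lambda>y. y \<in> V) n"
    "order_forest E (V - {n}) g = order_forest E (V - {n}) f"
proof -
  define g where "g = (Suc \<circ> f)(n := 0)"
  have "inj_on g V" using assms by (fastforce simp: g_def inj_on_def elimination_order_def)
  then have "elimination_order V g" using assms by (simp add: elimination_order_def)
  moreover have "is_arg_min g (\<lambda>y. y \<in> V) n" using assms(2) by (simp add: g_def is_arg_min_def)
  moreover have "order_forest E (V - {n}) g = order_forest E (V - {n}) f"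
    by (rule elimination_order.order_forest_strict_mono[OF assms(1)]) (auto simp: g_def)
  ultimately show thesis using that by blast
qed

lemma forest_del_surj:
  assumes "finite V" "n \<in> V" "elim_forest (V - {n}) E X"
  shows "\<exists>F. elim_forest V E F \<and> forest_del E V n F = X"
proof -
  obtain f where f: "elimination_order (V - {n}) f" "X = order_forest E (V - {n}) f"
    using assms elim_forest_iff_order[of "V - {n}"] by auto
  obtain g where g: "elimination_order V g"
    "order_forest E (V - {n}) g = order_forest E (V - {n}) f"
    using prepend_order[OF f(1) assms(2)] by metis
  then show ?thesis
    using f(2) assms(1) forest_del_order_forest elim_forest_iff_order[of V] by metis
qed

context elimination_order
begin

lemma order_forest_Diff_transpose:
  assumes "consecutive V f i n"
  shows "order_forest E (V - {n}) (f \<circ> transpose i n) = order_forest E (V - {n}) f"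
proof -
  interpret W: elimination_order E "V - {n}" f
    using finite inj by unfold_locales (auto intro: inj_on_subset)
  show ?thesis
  proof (rule W.order_forest_strict_mono)
    fix x y assume "x \<in> V - {n}" "y \<in> V - {n}" "f x < f y"
    then show "(f \<circ> transpose i n) x < (f \<circ> transpose i n) y"
      using consecutive_below_or_above[OF assms, of x] consecutive_below_or_above[OF assms, of y]
      by (cases "x = i"; cases "y = i") auto
  qed
qed

lemma obtain_predecessor:
  assumes "n \<in> V" "{w \<in> V. f w < f n} \<noteq> {}"
  obtains i where "consecutive V f i n" "f i < f n"
proof -
  let ?A = "{w \<in> V. f w < f n}"
  have "finite ?A" using finite by simp
  then obtain i where i: "i \<in> ?A" "Max (f ` ?A) = f i" using assms(2) by (rule obtains_MAX)
  have latest: "f w \<le> f i" if "w \<in> ?A" for w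
    using Max_ge[of "f ` ?A" "f w"] \<open>finite ?A\<close> that i(2) by simp
  have "f w < f i \<longleftrightarrow> f w < f n" if "w \<in> V - {i, n}" for w
    using latest[of w] inj_onD[OF inj, of w i] i(1) that by force
  then show thesis using that i(1) assms(1) by (auto simp: consecutive_def)
qed

end

lemma order_forest_eqI_first:
  assumes f: "elimination_order V f" "is_arg_min f (\<lambda>y. y \<in> V) n"
    and g: "elimination_order V g" "is_arg_min g (\<lambda>y. y \<in> V) n"
    and eq: "order_forest E (V - {n}) f = order_forest E (V - {n}) g"
  shows "order_forest E V f = order_forest E V g"
proof (rule order_forest_cong)
  have n: "n \<in> V" using f(2) by (simp add: is_arg_min_def)
  fix u assume u: "u \<in> V"
  show "tube E V f u = tube E V g u"
  proof (cases "u = n")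
    case True
    then show ?thesis
      using f(2) g(2) tube_first[OF n] component_subset[OF n, of E]
      by (simp add: is_arg_min_linorder subset_iff)
  next
    case False
    then have "tube E V f u = tube E (V - {n}) f u" "tube E V g u = tube E (V - {n}) g u"
      using elimination_order.first_less[OF f u] elimination_order.first_less[OF g u]
        tube_Diff_singleton by metis+
    then show ?thesis
      using order_forest_eq_imp_tube_eq[OF _ _ eq] u False
        elimination_order_subset[OF f(1)] elimination_order_subset[OF g(1)]
      by simp
  qed
qed

lemma order_forest_linked_to_first:
  assumes "elimination_order V f" "elimination_order V g" "is_arg_min g (\<lambda>y. y \<in> V) n"
    and "order_forest E (V - {n}) f = order_forest E (V - {n}) g"
  shows "(order_forest E V f, order_forest E V g) \<in> (\<Union>i. edge_rotations E V i n)\<^sup>*"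
  using assms(1,4)
proof (induction "card {w \<in> V. f w < f n}" arbitrary: f rule: less_induct)
  case less
  interpret elimination_order E V f by (fact less.prems(1))
  have n: "n \<in> V" using assms(3) by (simp add: is_arg_min_def)
  show ?case
  proof (cases "{w \<in> V. f w < f n} = {}")
    case True
    then have f_first: "is_arg_min f (\<lambda>y. y \<in> V) n" using n by (auto simp: is_arg_min_def)
    have "order_forest E V f = order_forest E V g"
      using order_forest_eqI_first[OF less.prems(1) f_first assms(2,3) less.prems(2)] .
    then show ?thesis by simp
  next
    case False
    then obtain i where i: "consecutive V f i n" "f i < f n" using obtain_predecessor n by blast
    let ?f = "f \<circ> transpose i n"
    have i_n: "i \<in> V" "i \<noteq> n" using i(1) by (auto simp: consecutive_def)
    have "?f w < ?f n \<longleftrightarrow> f w < f n \<and> w \<noteq> i" if "w \<in> V" for w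
      using i that i_n consecutive_below_or_above[OF i(1) that]
      by (cases "w = i"; cases "w = n") auto
    then have "{w \<in> V. ?f w < ?f n} = {w \<in> V. f w < f n} - {i}" by auto
    moreover have "card ({w \<in> V. f w < f n} - {i}) < card {w \<in> V. f w < f n}"
      using finite i(2) i_n by (intro card_Diff1_less) auto
    ultimately have "card {w \<in> V. ?f w < ?f n} < card {w \<in> V. f w < f n}" by simp
    then have "(order_forest E V ?f, order_forest E V g) \<in> (\<Union>i. edge_rotations E V i n)\<^sup>*"
      using less.hyps elimination_order_transpose[OF i_n(1) n] order_forest_Diff_transpose[OF i(1)]
        less.prems(2) by simp
    then show ?thesis
      using transpose_imp_edge_rotation[OF less.prems(1) i(1), of E]
      by (auto intro: converse_rtrancl_into_rtrancl)
  qed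
qed

lemma forest_del_eq_imp_linked:
  assumes "finite V" "n \<in> V" "elim_forest V E F" "elim_forest V E F'"
    and eq: "forest_del E V n F = forest_del E V n F'"
  shows "(F, F') \<in> (\<Union>i. edge_rotations E V i n)\<^sup>*"
proof -
  obtain f f' where f: "elimination_order V f" "F = order_forest E V f"
    and f': "elimination_order V f'" "F' = order_forest E V f'"
    using assms elim_forest_iff_order by metis
  obtain g where g: "elimination_order V g" "is_arg_min g (\<lambda>y. y \<in> V) n"
    "order_forest E (V - {n}) g = order_forest E (V - {n}) f"
    using prepend_order[of V n f] elimination_order_subset[OF f(1)] assms(2) by (metis Diff_subset)
  have "order_forest E (V - {n}) f = order_forest E (V - {n}) f'"
    using eq forest_del_order_forest f f' by metis
  then have "(F, order_forest E V g) \<in> (\<Union>i. edge_rotations E V i n)\<^sup>*"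
    "(F', order_forest E V g) \<in> (\<Union>i. edge_rotations E V i n)\<^sup>*"
    using order_forest_linked_to_first[OF f(1) g(1,2)] order_forest_linked_to_first[OF f'(1) g(1,2)]
      g(3) f(2) f'(2) by simp_all
  moreover have "sym ((\<Union>i. edge_rotations E V i n)\<^sup>*)"
    using sym_edge_rotations by (intro sym_rtrancl sym_UNION) auto
  ultimately show ?thesis by (meson rtrancl_trans symD)
qed

lemma edge_rotations_forest_del_eq:
  assumes "(F, F') \<in> edge_rotations E V i n"
  shows "forest_del E V n F' = forest_del E V n F"
  using assms
proof (rule edge_rotationsE)
  fix f
  assume "elimination_order V f" "elimination_order V (f \<circ> transpose i n)" "consecutive V f i n"
    and F: "F = order_forest E V f" "F' = order_forest E V (f \<circ> transpose i n)"
  then show ?thesis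
    unfolding F by (simp add: forest_del_order_forest elimination_order.order_forest_Diff_transpose)
qed

lemma edge_rotations_forest_del:
  assumes "(F, F') \<in> edge_rotations E V i j" "i \<noteq> n" "j \<noteq> n"
  shows "forest_del E V n F' = forest_del E V n F \<or>
    (forest_del E V n F, forest_del E V n F') \<in> edge_rotations E (V - {n}) i j"
  using assms(1)
proof (rule edge_rotationsE)
  fix f
  assume f: "elimination_order V f" "elimination_order V (f \<circ> transpose i j)" "consecutive V f i j"
    and F: "F = order_forest E V f" "F' = order_forest E V (f \<circ> transpose i j)"
  have "consecutive (V - {n}) f i j"
    using consecutive_subset[OF f(3)] f(3) assms(2,3) by (auto simp: consecutive_def)
  moreover have "elimination_order (V - {n}) f" using elimination_order_subset[OF f(1)] by simp
  ultimately show ?thesis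
    unfolding F forest_del_order_forest[OF f(1)] forest_del_order_forest[OF f(2)]
    by (intro transpose_imp_edge_rotation)
qed

lemma forest_del_rotation:
  assumes "finite V" "elim_forest V E F" "(a, b) \<in> F" "(a, b) \<in> forest_del E V n F"
  shows "forest_del E V n (rotation E F a b) = rotation E (forest_del E V n F) a b"
proof -
  obtain f where f: "elimination_order V f" "F = order_forest E V f"
    using assms elim_forest_iff_order by metis
  interpret f: elimination_order E V f by (fact f(1))
  obtain g where g: "elimination_order V g" "order_forest E V g = F"
    "consecutive V g a b" "g a < g b"
    using f.arc_imp_consecutive_order[of a b] assms(3) f(2) by metis
  interpret g: elimination_order E V g by (fact g(1))
  interpret W: elimination_order E "V - {n}" g
    using elimination_order_subset[OF g(1)] by simp
  have del: "forest_del E V n F = order_forest E (V - {n}) g"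
    using forest_del_order_forest g(1,2) by metis
  have arc: "(a, b) \<in> order_forest E V g" "(a, b) \<in> order_forest E (V - {n}) g"
    using assms(3,4) g(2) del by auto
  note ab = W.order_forestD[OF arc(2)]
  have "rotatable_pair E V g a b" using g g.order_forestD(3)[OF arc(1)] by unfold_locales
  then have "rotation E F a b = order_forest E V (g \<circ> transpose a b)"
    using rotatable_pair.rotation_eq_swapped g(2) by metis
  moreover have "rotatable_pair E (V - {n}) g a b"
    using ab consecutive_subset[OF g(3)] by unfold_locales auto
  then have "rotation E (forest_del E V n F) a b = order_forest E (V - {n}) (g \<circ> transpose a b)"
    using rotatable_pair.rotation_eq_swapped del by metis
  ultimately show ?thesis
    using forest_del_order_forest g.elimination_order_transpose[of a b] ab by simp
qed

section \<open>Vertices with few incident tree edges\<close>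

definition incident :: "'a rel \<Rightarrow> 'a \<Rightarrow> 'a set" where
  "incident F n = {i. (i, n) \<in> F \<or> (n, i) \<in> F}"

definition simplicial :: "'a set set \<Rightarrow> 'a set \<Rightarrow> 'a \<Rightarrow> bool" where
  "simplicial E V n \<longleftrightarrow> (\<forall>a\<in>V - {n}. \<forall>b\<in>V - {n}. a \<noteq> b \<longrightarrow> {n, a} \<in> E \<longrightarrow> {n, b} \<in> E \<longrightarrow> {a, b} \<in> E)"

lemma finite_incident:
  assumes "finite V" "elim_forest V E F"
  shows "finite (incident F n)"
proof -
  obtain f where "elimination_order V f" "F = order_forest E V f"
    using assms elim_forest_iff_order by metis
  then have "incident F n \<subseteq> V"
    using elimination_order.order_forest_subset by (fastforce simp: incident_def)
  then show ?thesis using assms(1) finite_subset by blast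
qed

lemma incident_imp_edge_rotation:
  assumes "finite V" "elim_forest V E F" "i \<in> incident F n"
  obtains F' where "(F, F') \<in> edge_rotations E V i n"
proof -
  obtain f where "elimination_order V f" "F = order_forest E V f"
    using assms elim_forest_iff_order by metis
  then show thesis
    using that assms(3) rotation_in_edge_rotations[of V f _ _ E] edge_rotations_commute[of E V i n]
    by (auto simp: incident_def)
qed

lemma component_Diff_simplicial:
  assumes u: "u \<in> A" "u \<noteq> n" and A: "component E A u = A" and n: "simplicial E A n"
  shows "component E (A - {n}) u = A - {n}"
proof
  let ?K = "component E (A - {n}) u"
  show K: "?K \<subseteq> A - {n}" by (rule component_subset) (use u in auto)
  have "component E A u \<subseteq> ?K \<union> {x. x = n \<and> (\<exists>k\<in>?K. {n, k} \<in> E)}" (is "_ \<subseteq> ?K \<union> ?N")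
  proof (rule component_minimal)
    fix x y assume x: "x \<in> ?K \<union> ?N" and xy: "x \<in> A" "y \<in> A" "{x, y} \<in> E"
    consider (into) "y = n" | (avoiding) "y \<noteq> n" "x \<noteq> n" | (out_of) "y \<noteq> n" "x = n" by blast
    then show "y \<in> ?K \<union> ?N"
    proof cases
      case into
      then show ?thesis using x xy by (auto simp: insert_commute)
    next
      case avoiding
      then show ?thesis using component_step[of x E "A - {n}" u y] x xy by simp
    next
      case out_of
      then obtain k where k: "k \<in> ?K" "{n, k} \<in> E" using x K by blast
      then have "k \<in> A - {n}" using K by blast
      moreover have "y \<in> A - {n}" "{n, y} \<in> E" using out_of xy by auto
      ultimately have "y = k \<or> {k, y} \<in> E"
        using n k(2) unfolding simplicial_def by metis
      then show ?thesis
        using component_step[of k E "A - {n}" u y] k \<open>k \<in> A - {n}\<close> \<open>y \<in> A - {n}\<close> by auto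
    qed
  qed simp
  then show "A - {n} \<subseteq> ?K" using A by auto
qed

lemma tube_Diff_simplicial:
  assumes "simplicial E V n" and u: "u \<in> V" "u \<noteq> n"
  shows "tube E (V - {n}) f u = tube E V f u - {n}"
proof -
  have "simplicial E (tube E V f u) n"
    using assms(1) tube_subset[OF u(1), of E f] unfolding simplicial_def by blast
  then show ?thesis
    using component_Diff_simplicial[of u "tube E V f u" n E] tube_connected[OF u(1), of E f]
      component_tube_Diff[OF u, of E f] u(2) by simp
qed

lemma tube_Diff_notin:
  assumes "n \<notin> tube E V f u" "u \<in> V"
  shows "tube E (V - {n}) f u = tube E V f u"
proof -
  have "u \<noteq> n" using assms(1) by auto
  then show ?thesis
    using component_tube_Diff[of u V n E f] tube_connected[of u V E f] assms by simp
qed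

lemma (in elimination_order) two_le_card_incident:
  assumes "u \<in> V" "n \<in> tube E V f u" "n \<noteq> u" and "v \<in> tube E V f n" "v \<noteq> n"
  shows "2 \<le> card (incident (order_forest E V f) n)"
proof -
  obtain p where p: "(p, n) \<in> order_forest E V f" using parent_exists[OF assms(1-3)] .
  have n: "n \<in> V" using order_forestD(2)[OF p] .
  obtain q where q: "(n, q) \<in> order_forest E V f" using child_exists[OF n assms(4,5)] .
  have "p \<noteq> q" using order_forestD(5)[OF p] order_forestD(5)[OF q] by auto
  moreover have "{p, q} \<subseteq> incident (order_forest E V f) n" using p q by (simp add: incident_def)
  moreover have "finite (incident (order_forest E V f) n)"
    using finite_incident elim_forest_iff_order finite elimination_order_axioms by metis
  ultimately show ?thesis using card_mono[of "incident (order_forest E V f) n" "{p, q}"] by simp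
qed

lemma order_forest_Diff_arc_lift:
  assumes f: "elimination_order V f" and n: "n \<in> V"
    and deg: "card (incident (order_forest E V f) n) \<le> 1"
    and nbhd: "simplicial E V n \<or> card (component E V n) \<le> 3"
    and arc: "(i, j) \<in> order_forest E (V - {n}) f"
  shows "(i, j) \<in> order_forest E V f"
proof -
  interpret elimination_order E V f by (fact f)
  interpret W: elimination_order E "V - {n}" f using elimination_order_subset[OF f] by simp
  note ij = W.order_forestD[OF arc]
  have Diff: "tube E (V - {n}) f u \<subseteq> tube E V f u" if "u \<in> V" "u \<noteq> n" for u
    using component_tube_Diff[OF that, of E f] component_subset[of u "tube E V f u - {n}" E] that
    by auto
  have "f w \<le> f i" if w: "w \<in> V" "j \<in> tube E V f w" "w \<noteq> j" for w
  proof (rule ccontr)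
    assume later: "\<not> f w \<le> f i"
    then have w_below: "w \<in> tube E V f i" "w \<noteq> i"
      using tube_chain[of i w j] Diff[of i] ij w by auto
    then have "w \<noteq> n" using two_le_card_incident[of i n j] deg ij w by auto
    then have "j \<notin> tube E (V - {n}) f w" using arc w later by (auto simp: W.order_forest_iff)
    then have neq: "tube E (V - {n}) f w \<noteq> tube E V f w - {n}" using w ij by blast
    then have "n \<in> tube E V f w" using tube_Diff_notin[of n E V f w] w by auto
    have "card (component E V n) \<le> 3" using nbhd neq tube_Diff_simplicial w(1) \<open>w \<noteq> n\<close> by metis
    moreover have "{i, w, j, n} \<subseteq> component E V i"
      using w w_below tube_mono[of i w] \<open>n \<in> tube E V f w\<close> ij tube_subset_component[of E V f i]
      by auto
    moreover from this have "component E V n = component E V i" by (intro component_eq) blast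
    moreover have "finite (component E V n)"
      using component_subset[OF n, of E] finite by (rule finite_subset)
    moreover have "card {i, w, j, n} = 4" using \<open>w \<noteq> n\<close> ij w_below w by auto
    ultimately show False using card_mono[of "component E V n" "{i, w, j, n}"] by simp
  qed
  then show ?thesis using ij Diff[of i] by (auto simp: order_forest_iff)
qed

lemma edge_rotations_forest_del_lift:
  assumes "finite V" "n \<in> V" and F: "elim_forest V E F"
    and "card (incident F n) \<le> 1" "simplicial E V n \<or> card (component E V n) \<le> 3"
    and X: "(forest_del E V n F, X) \<in> edge_rotations E (V - {n}) i j"
  shows "\<exists>F'. (F, F') \<in> edge_rotations E V i j \<and> forest_del E V n F' = X"
proof -
  obtain f where f: "elimination_order V f" "F = order_forest E V f"
    using F assms(1) elim_forest_iff_order by metis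
  obtain a b where ab: "a = i \<and> b = j \<or> a = j \<and> b = i" "(a, b) \<in> forest_del E V n F"
    "X = rotation E (forest_del E V n F) a b"
    using edge_rotations_imp_rotation[OF X] by blast
  have "(a, b) \<in> F"
    using order_forest_Diff_arc_lift[OF f(1) assms(2)] assms(4,5) ab(2) f(2)
      forest_del_order_forest[OF f(1)] by simp
  then have "(F, rotation E F a b) \<in> edge_rotations E V a b"
    "forest_del E V n (rotation E F a b) = X"
    using rotation_in_edge_rotations[OF f(1)] forest_del_rotation[OF assms(1) F] ab f(2) by auto
  then show ?thesis using ab(1) edge_rotations_commute by metis
qed

lemma nonsimplicial_four_vertices:
  assumes "\<not> simplicial E V n" "3 < card (component E V n)"
  obtains a b c where "{a, b, c} \<subseteq> V" "distinct [n, a, b, c]"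
    "n \<in> component E {c, n, a, b} c" "a \<in> component E {n, a, b} n" "b \<in> component E {n, a, b} n"
    "b \<notin> component E {a, b} a"
proof -
  obtain a b where ab: "a \<in> V - {n}" "b \<in> V - {n}" "a \<noteq> b"
    and E: "{n, a} \<in> E" "{n, b} \<in> E" "{a, b} \<notin> E"
    using assms(1) unfolding simplicial_def by blast
  have "\<not> component E V n \<subseteq> {n, a, b}"
  proof
    assume "component E V n \<subseteq> {n, a, b}"
    then have "card (component E V n) \<le> card {n, a, b}" by (intro card_mono) auto
    then show False using assms(2) ab(1-3) by auto
  qed
  then obtain z c where c: "c \<in> V" "c \<notin> {n, a, b}" and z: "z \<in> {n, a, b}" "{z, c} \<in> E"
    using component_minimal[of n "{n, a, b}" V E] by blast
  have "z \<in> component E {c, n, a, b} c"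
    using z component_step[of c E "{c, n, a, b}" c z] by (auto simp: insert_commute)
  then have "n \<in> component E {c, n, a, b} c"
    using z(1) E component_step[of z E "{c, n, a, b}" c n] by (auto simp: insert_commute)
  moreover have "a \<in> component E {n, a, b} n" "b \<in> component E {n, a, b} n"
    using E component_step[of n E "{n, a, b}" n] by auto
  moreover have "component E {a, b} a \<subseteq> {a}"
    by (rule component_minimal) (use E(3) in \<open>auto simp: insert_commute\<close>)
  ultimately show thesis using that[of a b c] ab c by auto
qed

lemma ex_card_incident_ge_3:
  assumes "finite V" "n \<in> V" "\<not> simplicial E V n" "3 < card (component E V n)"
  shows "\<exists>F. elim_forest V E F \<and> 3 \<le> card (incident F n)"
proof -
  obtain a b c where abc: "{a, b, c} \<subseteq> V" "distinct [n, a, b, c]"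
    and comp: "n \<in> component E {c, n, a, b} c" "a \<in> component E {n, a, b} n"
      "b \<in> component E {n, a, b} n" "b \<notin> component E {a, b} a"
    using nonsimplicial_four_vertices[OF assms(3,4)] .
  obtain e and N :: nat where e: "e ` V = {i. i < N}" "inj_on e V"
    using finite_imp_inj_to_nat_seg[OF assms(1)] by metis
  \<comment> \<open>Ending the order with \<open>c\<close>, \<open>n\<close>, \<open>a\<close>, \<open>b\<close> makes \<open>c\<close> the parent and \<open>a\<close>, \<open>b\<close> children of \<open>n\<close>.\<close>
  define f where "f = e(c := N, n := N + 1, a := N + 2, b := N + 3)"
  have e_less: "e w < N" if "w \<in> V" for w using e(1) that by blast
  have f: "f c = N" "f n = N + 1" "f a = N + 2" "f b = N + 3" using abc(2) by (auto simp: f_def)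
  have f_less: "f w < N" if "w \<in> V" "w \<notin> {a, b, c, n}" for w
    using e_less[OF that(1)] that(2) by (auto simp: f_def)
  have "inj_on f V"
    unfolding f_def by (intro inj_on_fun_updI e(2)) (auto dest!: e_less)
  then interpret elimination_order E V f using assms(1) by unfold_locales
  have "{w \<in> V. f c \<le> f w} = {c, n, a, b}" "{w \<in> V. f n \<le> f w} = {n, a, b}"
    "{w \<in> V. f a \<le> f w} = {a, b}"
    using f f_less abc(1) assms(2) by fastforce+
  then have tube: "n \<in> tube E V f c" "a \<in> tube E V f n" "b \<in> tube E V f n" "b \<notin> tube E V f a"
    using comp by (simp_all add: tube_def)
  have V: "a \<in> V" "b \<in> V" "c \<in> V" using abc(1) by auto
  have "w = b \<or> f w \<le> f n" if w: "w \<in> V" "b \<in> tube E V f w" for w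
    using f_less[OF w(1)] f tube(4) w(2) by (cases "w \<in> {a, b, c, n}") auto
  then have "(n, b) \<in> order_forest E V f"
    using assms(2) abc(2) tube(3) by (auto simp: order_forest_iff)
  moreover have "(c, n) \<in> order_forest E V f" "(n, a) \<in> order_forest E V f"
    using arc_if_successive[of c n] arc_if_successive[of n a] V assms(2) tube f by auto
  ultimately have "{a, b, c} \<subseteq> incident (order_forest E V f) n" by (simp add: incident_def)
  moreover have forest: "elim_forest V E (order_forest E V f)"
    using elim_forest_iff_order[OF finite] elimination_order_axioms by blast
  ultimately have "card {a, b, c} \<le> card (incident (order_forest E V f) n)"
    using finite_incident[OF finite] by (intro card_mono)
  moreover have "card {a, b, c} = 3" using abc(2) by simp
  ultimately show ?thesis using forest by auto
qed

section \<open>Runs of Algorithm R\<close>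

definition level_rotations :: "nat set set \<Rightarrow> nat rel \<Rightarrow> nat \<Rightarrow> (nat \<times> nat rel) set" where
  "level_rotations E F j = up_rotations E F j \<union> down_rotations E F j"

definition forced_rotation :: "nat set set \<Rightarrow> nat rel list \<Rightarrow> nat \<Rightarrow> nat \<Rightarrow> nat rel \<Rightarrow> bool" where
  "forced_rotation E Fs i j F \<longleftrightarrow>
     new_rotations E Fs j = {(i, F)} \<and> (\<forall>k>j. new_rotations E Fs k = {})"

lemma new_rotations_iff:
  "(i, F) \<in> new_rotations E Fs j \<longleftrightarrow> (i, F) \<in> level_rotations E (last Fs) j \<and> F \<notin> set Fs"
  by (simp add: new_rotations_def level_rotations_def)

lemma level_rotations_iff:
  assumes "finite V" "elim_forest V E F"
  shows "(i, F') \<in> level_rotations E F j \<longleftrightarrow> i < j \<and> (F, F') \<in> edge_rotations E V i j"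
proof -
  obtain f where f: "elimination_order V f" "F = order_forest E V f"
    using assms elim_forest_iff_order by metis
  have "(i, F') \<in> level_rotations E F j \<longleftrightarrow>
      i < j \<and> ((i, j) \<in> F \<and> F' = rotation E F i j \<or> (j, i) \<in> F \<and> F' = rotation E F j i)"
    by (auto simp: level_rotations_def up_rotations_def down_rotations_def)
  then show ?thesis
    using edge_rotations_imp_rotation rotation_in_edge_rotations[OF f(1)] f(2)
      edge_rotations_commute by metis
qed

lemma finite_new_rotations: "finite (new_rotations E Fs j)"
proof -
  have "new_rotations E Fs j \<subseteq>
      (\<lambda>i. (i, rotation E (last Fs) i j)) ` {..<j} \<union> (\<lambda>i. (i, rotation E (last Fs) j i)) ` {..<j}"
    by (auto simp: new_rotations_def up_rotations_def down_rotations_def)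
  then show ?thesis by (rule finite_subset) simp
qed

lemma finite_new_rotation_levels:
  assumes "finite V" "elim_forest V E (last Fs)"
  shows "finite {j. new_rotations E Fs j \<noteq> {}}"
proof -
  have "{j. new_rotations E Fs j \<noteq> {}} \<subseteq> V"
    using level_rotations_iff[OF assms] edge_rotations_imp_elim_forest(4)[OF assms(1)]
    by (fastforce simp: new_rotations_iff)
  then show ?thesis using assms(1) by (rule finite_subset)
qed

lemma alg_R_next_eq_Some_iff:
  assumes "finite V" "elim_forest V E (last Fs)"
  shows "alg_R_next E Fs = Some F \<longleftrightarrow> (\<exists>i j. forced_rotation E Fs i j F)"
proof -
  let ?J = "{j. new_rotations E Fs j \<noteq> {}}"
  let ?N = "new_rotations E Fs (Max ?J)"
  have J: "finite ?J" using finite_new_rotation_levels[OF assms] .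
  have next_eq: "alg_R_next E Fs =
      (if ?J = {} \<or> card ?N > 1 then None else Some (snd (the_elem ?N)))"
    by (simp add: alg_R_next_def Let_def)
  show ?thesis
  proof
    assume some: "alg_R_next E Fs = Some F"
    then have "?J \<noteq> {}" "card ?N \<le> 1" unfolding next_eq by (auto split: if_splits)
    moreover from this have "?N \<noteq> {}" using Max_in[OF J] by blast
    ultimately have "card ?N = 1" using finite_new_rotations[of E Fs] by (simp add: le_Suc_eq)
    then obtain i G where N: "?N = {(i, G)}" by (metis card_1_singletonE surj_pair)
    then have "G = F" using some unfolding next_eq by (simp split: if_splits)
    moreover have "new_rotations E Fs k = {}" if "k > Max ?J" for k
      using Max_ge[OF J, of k] that by force
    ultimately show "\<exists>i j. forced_rotation E Fs i j F"
      using N unfolding forced_rotation_def by blast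
  next
    assume "\<exists>i j. forced_rotation E Fs i j F"
    then obtain i j where j: "new_rotations E Fs j = {(i, F)}"
      "\<And>k. k > j \<Longrightarrow> new_rotations E Fs k = {}"
      unfolding forced_rotation_def by blast
    then have "Max ?J = j" using J by (intro Max_eqI) (auto simp: not_less[symmetric])
    moreover have "?J \<noteq> {}" using j(1) by blast
    ultimately show "alg_R_next E Fs = Some F" unfolding next_eq using j(1) by simp
  qed
qed

lemma alg_R_visits_Cons: "alg_R_visits E F0 Fs \<Longrightarrow> \<exists>Gs. Fs = F0 # Gs"
  by (induction rule: alg_R_visits.induct) auto

lemma alg_R_visits_step:
  "alg_R_visits E F0 Fs \<Longrightarrow> Suc t < length Fs \<Longrightarrow> alg_R_next E (take (Suc t) Fs) = Some (Fs ! Suc t)"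
  by (induction rule: alg_R_visits.induct) (auto simp: nth_append less_Suc_eq)

lemma alg_R_visits_forests:
  assumes "finite V" "elim_forest V E F0" "alg_R_visits E F0 Fs"
  shows "distinct Fs \<and> (\<forall>F\<in>set Fs. elim_forest V E F)"
  using assms(3)
proof (induction rule: alg_R_visits.induct)
  case start
  then show ?case using assms(2) by simp
next
  case (visit Fs F)
  have last: "elim_forest V E (last Fs)"
    using visit alg_R_visits_Cons by (metis last_in_set list.discI)
  obtain i j where "forced_rotation E Fs i j F"
    using visit.hyps(2) alg_R_next_eq_Some_iff[OF assms(1) last] by blast
  then have "(i, F) \<in> level_rotations E (last Fs) j" "F \<notin> set Fs"
    using new_rotations_iff[of i F E Fs j] by (auto simp: forced_rotation_def)
  then show ?case
    using visit.IH level_rotations_iff[OF assms(1) last]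
      edge_rotations_imp_elim_forest(2)[OF assms(1)] by auto
qed

lemma alg_R_terminates:
  assumes "finite V" "elim_forest V E F0"
  shows "\<exists>Fs. alg_R_terminates_with E F0 Fs"
proof -
  have "length Fs < Suc (card (Pow (V \<times> V)))" if "alg_R_visits E F0 Fs" for Fs
  proof -
    have "F \<subseteq> V \<times> V" if "elim_forest V E F" for F
      using that elim_forest_iff_order[OF assms(1)] elimination_order.order_forest_subset by metis
    then have "distinct Fs" "set Fs \<subseteq> Pow (V \<times> V)"
      using alg_R_visits_forests[OF assms that] by auto
    then show ?thesis
      using assms(1) card_mono[of "Pow (V \<times> V)" "set Fs"]
      by (simp add: distinct_card less_Suc_eq_le)
  qed
  then obtain Fs where Fs: "alg_R_visits E F0 Fs"
    and longest: "\<And>Gs. alg_R_visits E F0 Gs \<Longrightarrow> length Gs \<le> length Fs"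
    using ex_has_greatest_nat[of "alg_R_visits E F0" "[F0]" length "Suc (card (Pow (V \<times> V)))"]
      alg_R_visits.start by metis
  have "alg_R_next E Fs \<noteq> Some F" for F
    using longest[OF alg_R_visits.visit[OF Fs]] by auto
  then show ?thesis using Fs by (auto simp: alg_R_terminates_with_def)
qed

locale exhaustive_run =
  fixes E :: "nat set set" and V :: "nat set" and F0 :: "nat rel" and Fs :: "nat rel list"
    and n :: nat
  assumes finite: "finite V" and F0: "elim_forest V E F0" and run: "alg_R_visits E F0 Fs"
    and exhaustive: "\<And>F. elim_forest V E F \<Longrightarrow> F \<in> set Fs"
    and n: "n \<in> V" and n_max: "\<And>v. v \<in> V \<Longrightarrow> v \<le> n"
begin

abbreviation visited :: "nat \<Rightarrow> nat rel list" where
  "visited t \<equiv> take (Suc t) Fs"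

lemma distinct: "distinct Fs"
  using alg_R_visits_forests[OF finite F0 run] by blast

lemma forest_nth: "t < length Fs \<Longrightarrow> elim_forest V E (Fs ! t)"
  using alg_R_visits_forests[OF finite F0 run] by simp

lemma forest_index:
  assumes "elim_forest V E F"
  obtains t where "t < length Fs" "F = Fs ! t"
  using exhaustive[OF assms] by (auto simp: in_set_conv_nth)

lemma last_visited: "t < length Fs \<Longrightarrow> last (visited t) = Fs ! t"
  by (simp add: take_Suc_conv_app_nth)

lemma nth_in_visited_iff: "t < length Fs \<Longrightarrow> s < length Fs \<Longrightarrow> Fs ! t \<in> set (visited s) \<longleftrightarrow> t \<le> s"
  using nth_eq_iff_index_eq[OF distinct]
  by (auto simp: in_set_conv_nth intro!: exI[of _ t])

lemma forced_step:
  assumes "Suc t < length Fs"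
  obtains i j where "forced_rotation E (visited t) i j (Fs ! Suc t)"
    "i < j" "(Fs ! t, Fs ! Suc t) \<in> edge_rotations E V i j"
proof -
  have t: "t < length Fs" using assms by simp
  then have last: "elim_forest V E (last (visited t))" using last_visited forest_nth by simp
  then obtain i j where ij: "forced_rotation E (visited t) i j (Fs ! Suc t)"
    using alg_R_next_eq_Some_iff[OF finite] alg_R_visits_step[OF run assms] by blast
  then have "(i, Fs ! Suc t) \<in> level_rotations E (Fs ! t) j"
    using new_rotations_iff[of i "Fs ! Suc t" E "visited t" j] last_visited[OF t]
    by (simp add: forced_rotation_def)
  then show thesis using that ij level_rotations_iff[OF finite forest_nth[OF t]] by blast
qed

lemma top_rotation:
  assumes "Suc s < length Fs" "(i, F) \<in> new_rotations E (visited s) n"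
  shows "new_rotations E (visited s) n = {(i, Fs ! Suc s)}" "F = Fs ! Suc s"
proof -
  obtain k j where j: "forced_rotation E (visited s) k j (Fs ! Suc s)"
    "(Fs ! s, Fs ! Suc s) \<in> edge_rotations E V k j"
    using forced_step[OF assms(1)] by metis
  then have "j \<le> n" using n_max edge_rotations_imp_elim_forest(4)[OF finite] by blast
  moreover have "\<not> n > j" using j(1) assms(2) by (auto simp: forced_rotation_def)
  ultimately have "j = n" by simp
  then show "new_rotations E (visited s) n = {(i, Fs ! Suc s)}" "F = Fs ! Suc s"
    using j(1) assms(2) by (auto simp: forced_rotation_def)
qed

lemma top_rotation_consecutive:
  assumes "s < t" "t < length Fs" "(Fs ! s, Fs ! t) \<in> edge_rotations E V i n" "i < n"
  shows "(i, Fs ! t) \<in> new_rotations E (visited s) n" "t = Suc s"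
proof -
  have s: "s < length Fs" "Suc s < length Fs" using assms by auto
  show new: "(i, Fs ! t) \<in> new_rotations E (visited s) n"
    using assms s last_visited level_rotations_iff[OF finite forest_nth] nth_in_visited_iff
    by (simp add: new_rotations_iff)
  have "Fs ! t = Fs ! Suc s" using top_rotation(2)[OF s(2) new] .
  then show "t = Suc s" using nth_eq_iff_index_eq[OF distinct] assms(2) s(2) by simp
qed

definition departures :: "nat \<Rightarrow> nat set" where
  "departures s = fst ` new_rotations E (visited s) n"

definition arrivals :: "nat \<Rightarrow> nat set" where
  "arrivals s = (case s of 0 \<Rightarrow> {} | Suc r \<Rightarrow> departures r)"

lemma finite_departures: "finite (departures s)"
  by (simp add: departures_def finite_new_rotations)

lemma finite_arrivals: "finite (arrivals s)"
  by (simp add: arrivals_def finite_departures split: nat.split)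

lemma card_departures_le_1:
  assumes "s < length Fs"
  shows "card (departures s) \<le> 1"
proof (cases "new_rotations E (visited s) n = {}")
  case False
  then obtain i F where new: "(i, F) \<in> new_rotations E (visited s) n" by fast
  have "elim_forest V E F"
    using new assms last_visited level_rotations_iff[OF finite forest_nth]
      edge_rotations_imp_elim_forest(2)[OF finite] by (fastforce simp: new_rotations_iff)
  then obtain t where "t < length Fs" "F = Fs ! t" by (rule forest_index)
  then have "Suc s < length Fs" using new assms nth_in_visited_iff by (auto simp: new_rotations_iff)
  then show ?thesis using top_rotation(1)[OF _ new] by (simp add: departures_def)
qed (simp add: departures_def)

lemma card_arrivals_le_1: "s < length Fs \<Longrightarrow> card (arrivals s) \<le> 1"
  using card_departures_le_1 by (auto simp: arrivals_def split: nat.split)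

lemma incident_subset:
  assumes s: "s < length Fs"
  shows "incident (Fs ! s) n \<subseteq> departures s \<union> arrivals s"
proof
  fix i assume i: "i \<in> incident (Fs ! s) n"
  obtain F where rot: "(Fs ! s, F) \<in> edge_rotations E V i n"
    using incident_imp_edge_rotation[OF finite forest_nth[OF s] i] .
  note F = edge_rotations_imp_elim_forest[OF finite rot]
  have "i < n" using n_max[OF F(3)] edge_rotations_irrefl[OF rot] by simp
  obtain t where t: "t < length Fs" "F = Fs ! t" using F(2) by (rule forest_index)
  have "t \<noteq> s" using edge_rotations_irrefl[OF rot] t(2) by blast
  then consider (later) "s < t" | (earlier) "t < s" by linarith
  then show "i \<in> departures s \<union> arrivals s"
  proof cases
    case later
    then show ?thesis
      using top_rotation_consecutive(1)[OF later t(1)] rot t(2) \<open>i < n\<close>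
      by (force simp: departures_def)
  next
    case earlier
    have "(Fs ! t, Fs ! s) \<in> edge_rotations E V i n"
      using rot t(2) sym_edge_rotations by (metis symD)
    then show ?thesis
      using top_rotation_consecutive[OF earlier s] \<open>i < n\<close>
      by (force simp: arrivals_def departures_def)
  qed
qed

lemma card_incident_le:
  assumes s: "s < length Fs"
  shows "card (incident (Fs ! s) n) \<le> card (departures s) + 1"
proof -
  have "card (incident (Fs ! s) n) \<le> card (departures s \<union> arrivals s)"
    using incident_subset[OF s] finite_departures finite_arrivals by (intro card_mono) auto
  also have "\<dots> \<le> card (departures s) + card (arrivals s)" by (rule card_Un_le)
  finally show ?thesis using card_arrivals_le_1[OF s] by simp
qed

lemma simplicial_or_small: "simplicial E V n \<or> card (component E V n) \<le> 3"
proof (rule ccontr)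
  assume "\<not> ?thesis"
  then obtain F where F: "elim_forest V E F" "3 \<le> card (incident F n)"
    using ex_card_incident_ge_3[OF finite n] by (auto simp: not_le)
  obtain s where "s < length Fs" "F = Fs ! s" using F(1) by (rule forest_index)
  then show False using F(2) card_incident_le[of s] card_departures_le_1[of s] by simp
qed

abbreviation del :: "nat rel \<Rightarrow> nat rel" where
  "del \<equiv> forest_del E V n"

definition projection :: "nat \<Rightarrow> nat rel list" where
  "projection t = remdups_adj (map del (visited t))"

lemma set_projection [simp]: "set (projection t) = del ` set (visited t)"
  by (simp add: projection_def)

lemma map_visited: "t < length Fs \<Longrightarrow> map del (visited t) = map del (take t Fs) @ [del (Fs ! t)]"
  by (simp add: take_Suc_conv_app_nth)

lemma last_projection: "t < length Fs \<Longrightarrow> last (projection t) = del (Fs ! t)"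
  by (simp only: projection_def last_remdups_adj map_visited last_snoc)

lemma projection_Suc:
  assumes "Suc t < length Fs"
  shows "projection (Suc t) =
    (if del (Fs ! Suc t) = del (Fs ! t) then projection t else projection t @ [del (Fs ! Suc t)])"
proof -
  have t: "t < length Fs" using assms by simp
  have "map del (visited (Suc t)) = map del (take t Fs) @ [del (Fs ! t), del (Fs ! Suc t)]"
    unfolding map_visited[OF assms] map_visited[OF t] by simp
  then show ?thesis by (simp only: projection_def map_visited[OF t] remdups_adj_append_two) simp
qed

lemma fibre_contiguous:
  assumes t: "Suc t < length Fs" "del (Fs ! Suc t) \<noteq> del (Fs ! t)"
    and F: "F \<in> set (visited t)" "elim_forest V E F'" "del F = del F'"
  shows "F' \<in> set (visited t)"
proof -
  have "elim_forest V E F"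
    using F(1) alg_R_visits_forests[OF finite F0 run] in_set_takeD by fast
  then have "(F, F') \<in> (\<Union>i. edge_rotations E V i n)\<^sup>*"
    using forest_del_eq_imp_linked[OF finite n] F(2,3) by blast
  then show ?thesis using F(1)
  proof (induction rule: rtrancl_induct)
    case (step Y Z)
    obtain i where rot: "(Y, Z) \<in> edge_rotations E V i n" using step.hyps(2) by blast
    have "i < n"
      using n_max[OF edge_rotations_imp_elim_forest(3)[OF finite rot]]
        edge_rotations_irrefl[OF rot] by simp
    obtain x where x: "x \<le> t" "Y = Fs ! x" "x < length Fs"
      using step t(1) by (auto simp: in_set_conv_nth less_Suc_eq_le)
    obtain y where y: "y < length Fs" "Z = Fs ! y"
      using edge_rotations_imp_elim_forest(2)[OF finite rot] by (rule forest_index)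
    have "y \<le> t"
    proof (rule ccontr)
      assume "\<not> y \<le> t"
      moreover from this have "y = Suc x"
        using top_rotation_consecutive(2)[of x y i] rot x y \<open>i < n\<close> by simp
      ultimately have "x = t" "y = Suc t" using x(1) by auto
      then show False using edge_rotations_forest_del_eq[OF rot] t(2) x(2) y(2) by simp
    qed
    then show ?case using nth_in_visited_iff y t(1) by simp
  qed
qed

text \<open>
  The run leaves a fibre of \<open>del\<close> only when no rotation at \<open>n\<close> is new, that is, at a forest in
  which \<open>n\<close> has at most one incident edge; at such a forest rotations lift along \<open>del\<close>.
\<close>

lemma new_rotations_projection_subset:
  assumes t: "t < length Fs" and deg: "card (incident (Fs ! t) n) \<le> 1"
  shows "new_rotations E (projection t) m \<subseteq> map_prod id del ` new_rotations E (visited t) m"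
proof clarify
  fix i X assume X: "(i, X) \<in> new_rotations E (projection t) m"
  note forest = forest_nth[OF t]
  have "i < m" "(del (Fs ! t), X) \<in> edge_rotations E (V - {n}) i m"
    using X last_projection[OF t] finite
      level_rotations_iff[OF _ elim_forest_forest_del[OF finite forest]]
    by (auto simp: new_rotations_iff)
  then obtain F where F: "(Fs ! t, F) \<in> edge_rotations E V i m" "del F = X"
    using edge_rotations_forest_del_lift[OF finite n forest deg simplicial_or_small] by blast
  then have "F \<notin> set (visited t)" using X by (auto simp: new_rotations_iff)
  then have "(i, F) \<in> new_rotations E (visited t) m"
    using F(1) \<open>i < m\<close> last_visited[OF t] level_rotations_iff[OF finite forest]
    by (simp add: new_rotations_iff)
  then show "(i, X) \<in> map_prod id del ` new_rotations E (visited t) m" using F(2) by force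
qed

lemma forced_rotation_projection:
  assumes t: "Suc t < length Fs" and leave: "del (Fs ! Suc t) \<noteq> del (Fs ! t)"
  shows "\<exists>i j. forced_rotation E (projection t) i j (del (Fs ! Suc t))"
proof -
  have t': "t < length Fs" using t by simp
  obtain i j where forced: "forced_rotation E (visited t) i j (Fs ! Suc t)" and "i < j"
    and rot: "(Fs ! t, Fs ! Suc t) \<in> edge_rotations E V i j"
    using forced_step[OF t] .
  have "j \<noteq> n" using rot edge_rotations_forest_del_eq leave by metis
  moreover have "j \<in> V" using edge_rotations_imp_elim_forest(4)[OF finite rot] .
  ultimately have "j < n" using n_max by (simp add: order_less_le)
  then have "card (incident (Fs ! t) n) \<le> 1"
    using card_incident_le[OF t'] forced by (simp add: forced_rotation_def departures_def)
  note subset = new_rotations_projection_subset[OF t' this]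
  have "del (Fs ! Suc t) \<notin> set (projection t)"
    using fibre_contiguous[OF t leave _ forest_nth[OF t]] nth_in_visited_iff[OF t t'] by auto
  moreover have "(del (Fs ! t), del (Fs ! Suc t)) \<in> edge_rotations E (V - {n}) i j"
    using edge_rotations_forest_del[OF rot, of n] leave \<open>i < j\<close> \<open>j < n\<close> by simp
  ultimately have new: "(i, del (Fs ! Suc t)) \<in> new_rotations E (projection t) j"
    using last_projection[OF t'] finite \<open>i < j\<close>
      level_rotations_iff[OF _ elim_forest_forest_del[OF finite forest_nth[OF t']]]
    by (simp add: new_rotations_iff)
  have "new_rotations E (projection t) j \<subseteq> {(i, del (Fs ! Suc t))}"
    using subset[of j] forced by (simp add: forced_rotation_def)
  moreover have "new_rotations E (projection t) k = {}" if "k > j" for k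
    using subset[of k] forced that by (simp add: forced_rotation_def)
  ultimately show ?thesis using new unfolding forced_rotation_def by blast
qed

lemma alg_R_visits_projection:
  "t < length Fs \<Longrightarrow> alg_R_visits E (del F0) (projection t)"
proof (induction t)
  case 0
  then show ?case
    using alg_R_visits_Cons[OF run] alg_R_visits.start by (auto simp: projection_def)
next
  case (Suc t)
  then have IH: "alg_R_visits E (del F0) (projection t)" by simp
  show ?case
  proof (cases "del (Fs ! Suc t) = del (Fs ! t)")
    case True
    then show ?thesis using IH projection_Suc[OF Suc.prems] by simp
  next
    case False
    have "elim_forest (V - {n}) E (last (projection t))"
      using Suc.prems last_projection elim_forest_forest_del[OF finite forest_nth] by simp
    then have "alg_R_next E (projection t) = Some (del (Fs ! Suc t))"
      using forced_rotation_projection[OF Suc.prems False] alg_R_next_eq_Some_iff finite by blast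
    then show ?thesis using alg_R_visits.visit[OF IH] projection_Suc[OF Suc.prems] False by simp
  qed
qed

lemma reduced_exhaustive_run:
  obtains Gs where "alg_R_visits E (del F0) Gs" "elim_forest (V - {n}) E (del F0)"
    "\<And>F. elim_forest (V - {n}) E F \<Longrightarrow> F \<in> set Gs"
proof
  have "Fs \<noteq> []" using alg_R_visits_Cons[OF run] by blast
  then show "alg_R_visits E (del F0) (projection (length Fs - 1))"
    by (intro alg_R_visits_projection) simp
  show "elim_forest (V - {n}) E (del F0)" using elim_forest_forest_del[OF finite F0] .
  fix F assume "elim_forest (V - {n}) E F"
  then obtain G where "elim_forest V E G" "del G = F" using forest_del_surj[OF finite n] by blast
  then show "F \<in> set (projection (length Fs - 1))" using exhaustive by auto
qed

end

section \<open>Long induced cycles\<close>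

lemma induced_cycle_subset_component:
  assumes "induced_cycle V E xs" "n \<in> set xs"
  shows "set xs \<subseteq> component E V n"
proof -
  have xs: "set xs \<subseteq> V" "length xs \<ge> 3"
    and step: "{xs ! a, xs ! Suc a} \<in> E" if "Suc a < length xs" for a
    using assms(1) that unfolding induced_cycle_def by auto
  have "xs ! a \<in> component E V (xs ! 0)" if "a < length xs" for a
    using that
  proof (induction a)
    case (Suc a)
    then have "xs ! a \<in> V" "xs ! Suc a \<in> V" using xs(1) nth_mem Suc_lessD by blast+
    then show ?case using Suc component_step[of "xs ! a" E V "xs ! 0"] step[of a] by simp
  qed simp
  then have subset: "set xs \<subseteq> component E V (xs ! 0)" by (auto simp: in_set_conv_nth)
  then have "component E V n = component E V (xs ! 0)" using assms(2) by (intro component_eq) blast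
  then show ?thesis using subset by simp
qed

lemma induced_cycle_not_simplicial:
  assumes cycle: "induced_cycle V E xs" "length xs \<noteq> 3" and n: "n \<in> set xs"
  shows "\<not> simplicial E V n"
proof
  let ?k = "length xs"
  assume simplicial: "simplicial E V n"
  obtain p where p: "p < ?k" "n = xs ! p" using n by (auto simp: in_set_conv_nth)
  have k: "?k \<ge> 4" and dist: "distinct xs" and sub: "set xs \<subseteq> V"
    and adj: "\<And>a b. a < ?k \<Longrightarrow> b < ?k \<Longrightarrow>
      {xs ! a, xs ! b} \<in> E \<longleftrightarrow> b = Suc a mod ?k \<or> a = Suc b mod ?k"
    using cycle unfolding induced_cycle_def by auto
  have Suc_mod: "Suc a mod ?k = (if Suc a = ?k then 0 else Suc a)" if "a < ?k" for a
    using that by auto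
  define s r where "s = (if Suc p = ?k then 0 else Suc p)"
    and "r = (if p = 0 then ?k - 1 else p - 1)"
  have sr: "s < ?k" "r < ?k" "s \<noteq> p" "r \<noteq> p" "s \<noteq> r"
    using k p by (auto simp: s_def r_def split: if_splits)
  have "{n, xs ! s} \<in> E" "{n, xs ! r} \<in> E"
    unfolding p(2) adj[OF p(1) sr(1)] adj[OF p(1) sr(2)] Suc_mod[OF p(1)] Suc_mod[OF sr(2)]
    using p(1) by (auto simp: s_def r_def)
  moreover have "xs ! s \<in> V - {n}" "xs ! r \<in> V - {n}" "xs ! s \<noteq> xs ! r"
    using sr p dist sub by (auto simp: nth_eq_iff_index_eq)
  ultimately have "{xs ! s, xs ! r} \<in> E" using simplicial unfolding simplicial_def by metis
  then show False
    unfolding adj[OF sr(1,2)] Suc_mod[OF sr(1)] Suc_mod[OF sr(2)]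
    using k p(1) by (auto simp: s_def r_def split: if_splits)
qed

lemma long_induced_cycle_avoids:
  assumes cycle: "induced_cycle V E xs" "length xs \<noteq> 3" and "finite V"
    and n: "simplicial E V n \<or> card (component E V n) \<le> 3"
  shows "n \<notin> set xs"
proof
  assume mem: "n \<in> set xs"
  then have "card (component E V n) \<le> 3" using n induced_cycle_not_simplicial[OF cycle] by blast
  moreover have "n \<in> V" using cycle(1) mem by (auto simp: induced_cycle_def)
  then have "finite (component E V n)" using assms(3) component_subset finite_subset by metis
  then have "card (set xs) \<le> card (component E V n)"
    using induced_cycle_subset_component[OF cycle(1) mem] by (intro card_mono)
  moreover have "card (set xs) = length xs" "length xs \<ge> 3"
    using cycle(1) by (auto simp: induced_cycle_def distinct_card)
  ultimately show False using cycle(2) by simp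
qed

lemma chordal_image:
  assumes inj: "inj_on l V" and E: "\<And>e. e \<in> E \<Longrightarrow> e \<subseteq> V" and chordal: "chordal (l ` V) ((`) l ` E)"
  shows "chordal V E"
  unfolding chordal_def
proof (intro allI impI)
  fix xs assume xs: "induced_cycle V E xs"
  have "{l x, l y} \<in> (`) l ` E \<longleftrightarrow> {x, y} \<in> E" if "x \<in> V" "y \<in> V" for x y
  proof -
    have "l ` {x, y} \<in> (`) l ` E \<longleftrightarrow> {x, y} \<in> E"
      using inj_on_image_eq_iff[OF inj, of "{x, y}"] that E by blast
    then show ?thesis by simp
  qed
  moreover have "xs ! a \<in> V" if "a < length xs" for a
    using xs that by (auto simp: induced_cycle_def)
  moreover have "distinct (map l xs)"
    using xs inj by (auto simp: induced_cycle_def distinct_map intro: inj_on_subset)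
  ultimately have "induced_cycle (l ` V) ((`) l ` E) (map l xs)"
    using xs by (auto simp: induced_cycle_def)
  then show "length xs = 3" using chordal by (auto simp: chordal_def)
qed

section \<open>Incompleteness of Algorithm R\<close>

lemma run_misses_elim_forest:
  assumes "finite V" "\<not> chordal V E" "elim_forest V E F0" "alg_R_visits E F0 Fs"
  shows "\<exists>F. elim_forest V E F \<and> F \<notin> set Fs"
  using assms
proof (induction "card V" arbitrary: V F0 Fs rule: less_induct)
  case less
  show ?case
  proof (rule ccontr)
    assume exhaustive: "\<not> ?thesis"
    obtain xs where xs: "induced_cycle V E xs" "length xs \<noteq> 3"
      using less.prems(2) by (auto simp: chordal_def)
    then have "V \<noteq> {}" by (auto simp: induced_cycle_def)
    then interpret exhaustive_run E V F0 Fs "Max V"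
      using less.prems exhaustive by unfold_locales auto
    have "Max V \<notin> set xs" using long_induced_cycle_avoids[OF xs finite simplicial_or_small] .
    then have "induced_cycle (V - {Max V}) E xs" using xs(1) by (auto simp: induced_cycle_def)
    then have "\<not> chordal (V - {Max V}) E" using xs(2) by (auto simp: chordal_def)
    moreover have "card (V - {Max V}) < card V" using finite n by (rule card_Diff1_less)
    moreover obtain Gs where "alg_R_visits E (del F0) Gs" "elim_forest (V - {Max V}) E (del F0)"
      "\<And>F. elim_forest (V - {Max V}) E F \<Longrightarrow> F \<in> set Gs"
      using reduced_exhaustive_run by blast
    ultimately show False using less.hyps[of "V - {Max V}" "del F0" Gs] finite by blast
  qed
qed

theorem theorem38:
  fixes V :: "'a set" and E :: "'a set set" and n :: nat
    and l :: "'a \<Rightarrow> nat" and F0 :: "nat rel"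
  assumes "simple_graph V E"
    and "\<not> chordal V E"
    and "bij_betw l V {1..n}"
    and "elim_forest {1..n} ((`) l ` E) F0"
  shows "\<exists>Fs. alg_R_terminates_with ((`) l ` E) F0 Fs \<and>
           (\<exists>F. elim_forest {1..n} ((`) l ` E) F \<and> F \<notin> set Fs)"
proof -
  have not_chordal: "\<not> chordal {1..n} ((`) l ` E)"
    using chordal_image[of l V E] assms(1-3) by (auto simp: simple_graph_def bij_betw_def)
  obtain Fs where Fs: "alg_R_terminates_with ((`) l ` E) F0 Fs"
    using alg_R_terminates[OF _ assms(4)] by auto
  then have "\<exists>F. elim_forest {1..n} ((`) l ` E) F \<and> F \<notin> set Fs"
    using run_misses_elim_forest[OF _ not_chordal assms(4)] by (simp add: alg_R_terminates_with_def)
  with Fs show ?thesis by blast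
qed

end
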